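(* Let $K$ be any field and $R = K[x_1, \ldots, x_d]$. For any prime ideal $Q$ in $R$ and any integer $n \geqslant 1$, \[ Q^{(n)} = \{ f \in R \mid \partial(f) \in Q \text{ for all } \partial \in D^{n-1}_{R|\mathbb{Z}} \}.\]
   Context: Rings are commutative with unity. For a prime ideal $Q$ of a ring $R$ and $n\geqslant 1$, the $n$th symbolic power is $Q^{(n)} = Q^nR_Q\cap R$, i.e. the preimage of $Q^nR_Q$ under the localization map $R\to R_Q$. For a ring $A$ and an $A$-algebra $R$, the module $D^n_{R|A}\subseteq \operatorname{Hom}_A(R,R)$ of $A$-linear differential operators on $R$ of order at most $n$ is defined inductively by $D^0_{R|A}=\operatorname{Hom}_R(R,R)$ and, for $n\geqslant 1$, $D^n_{R|A}=\{\partial\in\operatorname{Hom}_A(R,R)\mid \partial\circ\mu_r-\mu_r\circ\partial\in D^{n-1}_{R|A}\text{ for every } r\in R\}$, where $\mu_r$ is multiplication by $r$. Here $A=\mathbb{Z}$. *)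

theory Defs
  imports "HOL-Algebra.Algebra" "HOL-Library.Poly_Mapping"
begin

text \<open>
  \<open>mpoly_ring d\<close> is \<open>K[x\<^sub>1, \<dots>, x\<^sub>d]\<close>, where \<open>K\<close> is the type \<open>'k\<close>. A monomial is an exponent
  vector \<open>nat \<Rightarrow>\<^sub>0 nat\<close>, multiplication of \<open>(nat \<Rightarrow>\<^sub>0 nat) \<Rightarrow>\<^sub>0 'k\<close> is convolution, and the
  carrier consists of the polynomials in which only the variables with index \<open>< d\<close> occur.
\<close>

definition mpoly_ring :: "nat \<Rightarrow> ((nat \<Rightarrow>\<^sub>0 nat) \<Rightarrow>\<^sub>0 'k::field) ring" where
  "mpoly_ring d =
    \<lparr>carrier = {p. \<forall>m \<in> Poly_Mapping.keys p. Poly_Mapping.keys m \<subseteq> {..<d}},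
     monoid.mult = (*), one = 1, ring.zero = 0, add = (+)\<rparr>"

lemma domain_mpoly_ring: "domain (mpoly_ring d :: ((nat \<Rightarrow>\<^sub>0 nat) \<Rightarrow>\<^sub>0 'k::field) ring)"
  (is "domain ?R")
proof -
  let ?C = "carrier ?R"
  have add: "p + q \<in> ?C" if "p \<in> ?C" "q \<in> ?C" for p q
    using that keys_add[of p q] unfolding mpoly_ring_def by auto
  have mult: "p * q \<in> ?C" if "p \<in> ?C" "q \<in> ?C" for p q
  proof -
    have "Poly_Mapping.keys m \<subseteq> {..<d}" if m: "m \<in> Poly_Mapping.keys (p * q)" for m
    proof -
      obtain a b where "m = a + b" "a \<in> Poly_Mapping.keys p" "b \<in> Poly_Mapping.keys q"
        using keys_mult[of p q] m by auto
      then show ?thesis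
        using \<open>p \<in> ?C\<close> \<open>q \<in> ?C\<close> keys_add[of a b]
        by (simp add: mpoly_ring_def) (meson Un_least order_trans)
    qed
    then show ?thesis unfolding mpoly_ring_def by auto
  qed
  have uminus: "- p \<in> ?C" if "p \<in> ?C" for p
    using that unfolding mpoly_ring_def by (auto simp: in_keys_iff)
  have simps: "0 \<in> ?C" "1 \<in> ?C"
    "monoid.mult ?R = (*)" "ring.add ?R = (+)" "\<zero>\<^bsub>?R\<^esub> = 0" "\<one>\<^bsub>?R\<^esub> = 1"
    by (simp_all add: mpoly_ring_def)
  have cring: "cring ?R"
  proof (intro cringI abelian_groupI comm_monoidI)
    fix p assume "p \<in> ?C"
    then show "\<exists>q \<in> ?C. q \<oplus>\<^bsub>?R\<^esub> p = \<zero>\<^bsub>?R\<^esub>"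
      using uminus by (intro bexI[of _ "- p"]) (simp_all add: simps)
  qed (simp_all only: simps add mult ac_simps distrib_left distrib_right
      add_0 add_0_right mult_1 mult_1_right)
  show ?thesis
    by (rule domain.intro[OF cring], rule domain_axioms.intro) (simp_all add: simps)
qed

context
  fixes R :: "('a, 'm) ring_scheme" (structure) and S :: "'a set"
begin

definition loc_rel :: "(('a \<times> 'a) \<times> ('a \<times> 'a)) set" where
  "loc_rel = {((a, s), (b, t)). a \<in> carrier R \<and> s \<in> S \<and> b \<in> carrier R \<and> t \<in> S \<and>
     (\<exists>u \<in> S. u \<otimes> (t \<otimes> a \<ominus> s \<otimes> b) = \<zero>)}"

definition loc_frac :: "'a \<Rightarrow> 'a \<Rightarrow> ('a \<times> 'a) set" where
  "loc_frac a s = loc_rel `` {(a, s)}"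

definition localization :: "('a \<times> 'a) set ring" where
  "localization =
    \<lparr>carrier = (carrier R \<times> S) // loc_rel,
     monoid.mult = (\<lambda>U V. \<Union>(a, s) \<in> U. \<Union>(b, t) \<in> V. loc_frac (a \<otimes> b) (s \<otimes> t)),
     one = loc_frac \<one> \<one>,
     ring.zero = loc_frac \<zero> \<one>,
     add = (\<lambda>U V. \<Union>(a, s) \<in> U. \<Union>(b, t) \<in> V. loc_frac (t \<otimes> a \<oplus> s \<otimes> b) (s \<otimes> t))\<rparr>"

definition localization_map :: "'a \<Rightarrow> ('a \<times> 'a) set" where
  "localization_map a = loc_frac a \<one>"

end

text \<open>
  \<open>Q\<^sup>(\<^sup>n\<^sup>)\<close> is the preimage of \<open>Q\<^sup>n R\<^sub>Q\<close> under \<open>R \<rightarrow> R\<^sub>Q\<close>. The power \<open>Q\<^sup>n\<close> is taken in the monoid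
  of ideals under the ideal product, and \<open>Q\<^sup>n R\<^sub>Q\<close> is the ideal of \<open>R\<^sub>Q\<close> generated by its image.
\<close>

definition symbolic_power :: "('a, 'm) ring_scheme \<Rightarrow> 'a set \<Rightarrow> nat \<Rightarrow> 'a set" where
  "symbolic_power R Q n =
    (let S = carrier R - Q; \<phi> = localization_map R S
     in {f \<in> carrier R. \<phi> f \<in> genideal (localization R S) (\<phi> ` (Q [^]\<^bsub>ideals_set R\<^esub> n))})"

text \<open>
  An \<open>A\<close>-algebra \<open>R\<close> is given by its structure map \<open>\<phi> : A \<rightarrow> R\<close>. Operators are represented by
  functions on the whole type of which only the values on \<open>carrier R\<close> matter: no condition
  below constrains the values elsewhere.
\<close>

definition linear_endos ::
    "('b, 'n) ring_scheme \<Rightarrow> ('b \<Rightarrow> 'a) \<Rightarrow> ('a, 'm) ring_scheme \<Rightarrow> ('a \<Rightarrow> 'a) set" where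
  "linear_endos A \<phi> R =
    {\<delta> \<in> hom (add_monoid R) (add_monoid R).
       \<forall>a \<in> carrier A. \<forall>x \<in> carrier R. \<delta> (\<phi> a \<otimes>\<^bsub>R\<^esub> x) = \<phi> a \<otimes>\<^bsub>R\<^esub> \<delta> x}"

primrec diff_ops ::
    "('b, 'n) ring_scheme \<Rightarrow> ('b \<Rightarrow> 'a) \<Rightarrow> ('a, 'm) ring_scheme \<Rightarrow> nat \<Rightarrow> ('a \<Rightarrow> 'a) set" where
  "diff_ops A \<phi> R 0 = linear_endos R id R"
| "diff_ops A \<phi> R (Suc n) =
    {\<delta> \<in> linear_endos A \<phi> R.
       \<forall>r \<in> carrier R. (\<lambda>x. \<delta> (r \<otimes>\<^bsub>R\<^esub> x) \<ominus>\<^bsub>R\<^esub> r \<otimes>\<^bsub>R\<^esub> \<delta> x) \<in> diff_ops A \<phi> R n}"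

definition diff_ops_int :: "('a, 'm) ring_scheme \<Rightarrow> nat \<Rightarrow> ('a \<Rightarrow> 'a) set" where
  "diff_ops_int R n = diff_ops \<Z> (\<lambda>k. add_pow R k \<one>\<^bsub>R\<^esub>) R n"

end

theory Submission
  imports Defs "HOL-Computational_Algebra.Polynomial_Factorial"
begin

text \<open>
  Write \<open>O = R\<^sub>Q\<close>, \<open>M\<^sub>j = Q\<^sup>j R\<^sub>Q\<close> and \<open>A = O / M\<^sub>n\<close>, a local ring with residue field \<open>k\<close>.
  A polynomial \<open>f\<close> lies in \<open>Q\<^sup>(\<^sup>n\<^sup>)\<close> iff \<open>s f \<in> Q\<^sup>n\<close> for some \<open>s \<notin> Q\<close>, that is, iff \<open>f\<close> vanishes
  in \<open>A\<close> (\<open>mem_symbolic_power_iff\<close>).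

  One inclusion holds over every domain (\<open>diff_ops_symbolic_power\<close>): the commutator of an operator
  with multiplication by an element has smaller order, so by induction an operator of order
  \<open>k\<close> sends \<open>Q\<^sup>k\<^sup>+\<^sup>1\<close> into \<open>Q\<close>, and a denominator \<open>s\<close> can be moved past the operator.

  For the other inclusion every \<open>f\<close> that is nonzero in \<open>A\<close> must be detected by an operator.
  Over a perfect field, derivations and divided powers in a system of parameters would do this.
  In general \<open>k\<close> can be inseparable over \<open>K\<close>, and then, for \<open>n \<ge> 2\<close>, no coefficient field of \<open>A\<close>
  contains \<open>K\<close>. But the operators are only \<open>\<int>\<close>-linear, and \<open>A\<close> does have some coefficient field:
  every field lifts, as an algebra over its prime field, along nilpotent thickenings (\<open>ex_section\<close>,
  \<open>ex_coefficient_ring\<close>). Reducing an element of \<open>K\<close> to \<open>k\<close> and lifting it to the coefficient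
  field gives a second embedding \<open>s : K \<rightarrow> A\<close>, congruent to the inclusion modulo \<open>M\<^sub>1\<close>.

  Decompose the variables in the same way: \<open>x\<^sub>i = y\<^sub>i + t\<^sub>i\<close> with \<open>y\<^sub>i\<close> in the coefficient field and
  \<open>t\<^sub>i \<in> M\<^sub>1\<close>. Consider two ring homomorphisms \<open>T, S : R \<rightarrow> A[X\<^sub>1, \<dots>, X\<^sub>d]\<close>. The Taylor map
  \<open>T\<close> is the inclusion on \<open>K\<close> and sends \<open>x\<^sub>i\<close> to \<open>X\<^sub>i + t\<^sub>i\<close>; the scalar map \<open>S\<close> is \<open>s\<close> on \<open>K\<close> and
  sends \<open>x\<^sub>i\<close> to \<open>X\<^sub>i\<close>. They agree modulo \<open>M\<^sub>1\<close>. Let \<open>\<mu> : A \<rightarrow> K\<close> be a functional that is \<open>K\<close>-linear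
  for \<open>s\<close>. Applied to coefficients it is \<open>R\<close>-linear for \<open>S\<close>, so the commutator of
  \<open>g \<mapsto> \<mu> (z T(g))\<close> with multiplication by \<open>r\<close> is the operator of the same form with
  \<open>z (T(r) - S(r))\<close> in place of \<open>z\<close>. Each commutator moves \<open>z\<close> one step down the filtration, and
  after \<open>n\<close> steps it is zero. Hence \<open>g \<mapsto> \<mu> (T(g))\<close> has order at most \<open>n - 1\<close>
  (\<open>functional_diff_op\<close>).

  These operators suffice. Linear algebra over \<open>K\<close> gives finitely many functionals
  \<open>\<mu>\<^sub>j\<close> and \<open>w\<^sub>j \<in> A\<close> with \<open>T(f) = \<Sum>\<^sub>j w\<^sub>j S(\<mu>\<^sub>j (T(f)))\<close> (\<open>ex_dual_family\<close>). The evaluation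
  \<open>X\<^sub>i \<mapsto> y\<^sub>i\<close> turns \<open>T(f)\<close> back into \<open>f\<close> and kills \<open>S(Q)\<close>, because the values of \<open>S\<close> end up in the
  coefficient field. So if all \<open>\<mu>\<^sub>j (T(f))\<close> lie in \<open>Q\<close>, then \<open>f\<close> is zero in \<open>A\<close>
  (\<open>mem_Mn_if_diff_ops\<close>).

  Quotient rings are replaced by congruences throughout: \<open>A\<close> and its coefficient
  field are represented by subrings of the fraction field of the polynomial type, and maps to \<open>A\<close>
  by maps to \<open>O\<close> that respect the operations modulo \<open>M\<^sub>n\<close>.
\<close>

section \<open>Symbolic powers and differential operators over a domain\<close>

locale domain_with_denominators = domain R for R :: "('a, 'm) ring_scheme" (structure) +
  fixes S :: "'a set"
  assumes S_carrier: "S \<subseteq> carrier R" and one_S: "\<one> \<in> S"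
    and S_mult: "s \<in> S \<Longrightarrow> t \<in> S \<Longrightarrow> s \<otimes> t \<in> S" and zero_S: "\<zero> \<notin> S"
begin

abbreviation "quot \<equiv> loc_frac R S"
abbreviation "Loc \<equiv> localization R S"

lemma S_closed [simp]: "s \<in> S \<Longrightarrow> s \<in> carrier R" using S_carrier by blast
declare one_S [simp] S_mult [simp]

lemma S_nonzero [simp]: "s \<in> S \<Longrightarrow> s \<noteq> \<zero>" using zero_S by blast

text \<open>
  In a domain the factor \<open>u\<close> in the definition of fractions cancels, which leaves cross
  multiplication.
\<close>

lemma loc_rel_iff:
  "((a, s), (b, t)) \<in> loc_rel R S \<longleftrightarrow>
    a \<in> carrier R \<and> s \<in> S \<and> b \<in> carrier R \<and> t \<in> S \<and> t \<otimes> a = s \<otimes> b"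
proof -
  have "u \<otimes> (t \<otimes> a \<ominus> s \<otimes> b) = \<zero> \<longleftrightarrow> t \<otimes> a = s \<otimes> b"
    if "a \<in> carrier R" "b \<in> carrier R" "s \<in> S" "t \<in> S" "u \<in> S" for u
  proof -
    have "u \<otimes> (t \<otimes> a \<ominus> s \<otimes> b) = \<zero> \<longleftrightarrow> t \<otimes> a \<ominus> s \<otimes> b = \<zero>"
      using that by (auto simp: integral_iff)
    then show ?thesis using that r_right_minus_eq[of "t \<otimes> a" "s \<otimes> b"] by simp
  qed
  then show ?thesis unfolding loc_rel_def using one_S by auto
qed

lemma equiv_loc_rel: "equiv (carrier R \<times> S) (loc_rel R S)"
proof (rule equivI)
  show "loc_rel R S \<subseteq> (carrier R \<times> S) \<times> (carrier R \<times> S)"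
    by (auto simp: loc_rel_iff)
  show "refl_on (carrier R \<times> S) (loc_rel R S)" by (auto simp: refl_on_def loc_rel_iff)
  show "sym (loc_rel R S)" by (auto simp: sym_def loc_rel_iff)
  show "trans (loc_rel R S)"
  proof (rule transI, clarify)
    fix a s b t c u
    assume 1: "((a, s), (b, t)) \<in> loc_rel R S" and 2: "((b, t), (c, u)) \<in> loc_rel R S"
    have cl: "a \<in> carrier R" "b \<in> carrier R" "c \<in> carrier R" "s \<in> S" "t \<in> S" "u \<in> S"
      and eq: "t \<otimes> a = s \<otimes> b" "u \<otimes> b = t \<otimes> c" using 1 2 by (auto simp: loc_rel_iff)
    have "t \<otimes> (u \<otimes> a) = u \<otimes> (t \<otimes> a)" using cl by (simp add: m_lcomm)
    also have "\<dots> = s \<otimes> (u \<otimes> b)" using cl eq by (simp add: m_lcomm)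
    also have "\<dots> = t \<otimes> (s \<otimes> c)" using cl eq by (simp add: m_lcomm)
    finally have "u \<otimes> a = s \<otimes> c" using cl m_lcancel[of t "u \<otimes> a" "s \<otimes> c"] by simp
    then show "((a, s), (c, u)) \<in> loc_rel R S" using cl by (simp add: loc_rel_iff)
  qed
qed

lemma quot_eq_iff:
  assumes "a \<in> carrier R" "s \<in> S" "b \<in> carrier R" "t \<in> S"
  shows "quot a s = quot b t \<longleftrightarrow> t \<otimes> a = s \<otimes> b"
  using eq_equiv_class_iff[OF equiv_loc_rel, of "(a, s)" "(b, t)"] assms
  by (simp add: loc_frac_def loc_rel_iff)

lemma mem_quot_iff:
  assumes "a \<in> carrier R" "s \<in> S"
  shows "(b, t) \<in> quot a s \<longleftrightarrow> b \<in> carrier R \<and> t \<in> S \<and> t \<otimes> a = s \<otimes> b"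
  using assms by (simp add: loc_frac_def loc_rel_iff)

text \<open>
  The operations of the localization are unions over all representatives; when all members of the
  union coincide, the union is their common value.
\<close>

lemma UN_quot:
  assumes "a \<in> carrier R" "s \<in> S" "b \<in> carrier R" "t \<in> S"
    and "\<And>a' s' b' t'. (a', s') \<in> quot a s \<Longrightarrow> (b', t') \<in> quot b t \<Longrightarrow> F a' s' b' t' = Z"
  shows "(\<Union>(a, s)\<in>quot a s. \<Union>(b, t)\<in>quot b t. F a s b t) = Z"
proof -
  have "(a, s) \<in> quot a s" "(b, t) \<in> quot b t" using assms by (simp_all add: mem_quot_iff)
  then show ?thesis using assms(5) by fastforce
qed

lemma quot_mult:
  assumes "a \<in> carrier R" "s \<in> S" "b \<in> carrier R" "t \<in> S"
  shows "quot a s \<otimes>\<^bsub>Loc\<^esub> quot b t = quot (a \<otimes> b) (s \<otimes> t)"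
proof -
  have "quot (a' \<otimes> b') (s' \<otimes> t') = quot (a \<otimes> b) (s \<otimes> t)"
    if "(a', s') \<in> quot a s" "(b', t') \<in> quot b t" for a' s' b' t'
  proof -
    have cl: "a' \<in> carrier R" "b' \<in> carrier R" "s' \<in> S" "t' \<in> S"
      and eq: "s' \<otimes> a = s \<otimes> a'" "t' \<otimes> b = t \<otimes> b'" using that assms by (auto simp: mem_quot_iff)
    have "(s' \<otimes> t') \<otimes> (a \<otimes> b) = (s' \<otimes> a) \<otimes> (t' \<otimes> b)" using assms cl by (simp add: m_ac)
    also have "\<dots> = (s \<otimes> t) \<otimes> (a' \<otimes> b')" unfolding eq using assms cl by (simp add: m_ac)
    finally show ?thesis using assms cl by (subst quot_eq_iff) auto
  qed
  then show ?thesis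
    using UN_quot[OF assms, of "\<lambda>a s b t. quot (a \<otimes> b) (s \<otimes> t)"] by (simp add: localization_def)
qed

lemma quot_add:
  assumes "a \<in> carrier R" "s \<in> S" "b \<in> carrier R" "t \<in> S"
  shows "quot a s \<oplus>\<^bsub>Loc\<^esub> quot b t = quot (t \<otimes> a \<oplus> s \<otimes> b) (s \<otimes> t)"
proof -
  have "quot (t' \<otimes> a' \<oplus> s' \<otimes> b') (s' \<otimes> t') = quot (t \<otimes> a \<oplus> s \<otimes> b) (s \<otimes> t)"
    if "(a', s') \<in> quot a s" "(b', t') \<in> quot b t" for a' s' b' t'
  proof -
    have cl: "a' \<in> carrier R" "b' \<in> carrier R" "s' \<in> S" "t' \<in> S"
      and eq: "s' \<otimes> a = s \<otimes> a'" "t' \<otimes> b = t \<otimes> b'" using that assms by (auto simp: mem_quot_iff)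
    have "(s' \<otimes> t') \<otimes> (t \<otimes> a \<oplus> s \<otimes> b) = (t \<otimes> t') \<otimes> (s' \<otimes> a) \<oplus> (s \<otimes> s') \<otimes> (t' \<otimes> b)"
      using assms cl by (simp add: r_distr m_ac)
    also have "\<dots> = (s \<otimes> t) \<otimes> (t' \<otimes> a' \<oplus> s' \<otimes> b')"
      unfolding eq using assms cl by (simp add: r_distr m_ac)
    finally show ?thesis using assms cl by (subst quot_eq_iff) auto
  qed
  then show ?thesis
    using UN_quot[OF assms, of "\<lambda>a s b t. quot (t \<otimes> a \<oplus> s \<otimes> b) (s \<otimes> t)"]
    by (simp add: localization_def)
qed

lemma carrier_Loc: "carrier Loc = {quot a s | a s. a \<in> carrier R \<and> s \<in> S}"
  by (auto simp: localization_def quotient_def loc_frac_def)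

lemma quot_closed [simp]: "a \<in> carrier R \<Longrightarrow> s \<in> S \<Longrightarrow> quot a s \<in> carrier Loc"
  by (auto simp: carrier_Loc)

lemma Loc_cases:
  assumes "x \<in> carrier Loc"
  obtains a s where "x = quot a s" "a \<in> carrier R" "s \<in> S"
  using assms by (auto simp: carrier_Loc)

lemma Loc_zero_one: "\<zero>\<^bsub>Loc\<^esub> = quot \<zero> \<one>" "\<one>\<^bsub>Loc\<^esub> = quot \<one> \<one>"
  by (simp_all add: localization_def)

lemmas Loc_simps = quot_mult quot_add Loc_zero_one quot_eq_iff

text \<open>
  The ideal generated by a set is the intersection of the ideals containing it, so that
  \<open>genideal\<close> is meaningful in the localization only after the ring axioms are known there.
\<close>

lemma cring_localization: "cring Loc"
proof (intro cringI abelian_groupI comm_monoidI)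
  fix x assume "x \<in> carrier Loc"
  then obtain a s where x: "x = quot a s" "a \<in> carrier R" "s \<in> S" by (rule Loc_cases)
  then have "quot (\<ominus> a) s \<oplus>\<^bsub>Loc\<^esub> x = \<zero>\<^bsub>Loc\<^esub>"
    by (simp add: Loc_simps r_minus l_neg)
  then show "\<exists>y\<in>carrier Loc. y \<oplus>\<^bsub>Loc\<^esub> x = \<zero>\<^bsub>Loc\<^esub>" using x by (intro bexI[of _ "quot (\<ominus> a) s"]) auto
  show "\<zero>\<^bsub>Loc\<^esub> \<oplus>\<^bsub>Loc\<^esub> x = x" "\<one>\<^bsub>Loc\<^esub> \<otimes>\<^bsub>Loc\<^esub> x = x" using x by (simp_all add: Loc_simps)
  fix y assume "y \<in> carrier Loc"
  then obtain b t where y: "y = quot b t" "b \<in> carrier R" "t \<in> S" by (rule Loc_cases)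
  show "x \<oplus>\<^bsub>Loc\<^esub> y \<in> carrier Loc" "x \<otimes>\<^bsub>Loc\<^esub> y \<in> carrier Loc" using x y by (simp_all add: Loc_simps)
  show "x \<oplus>\<^bsub>Loc\<^esub> y = y \<oplus>\<^bsub>Loc\<^esub> x" "x \<otimes>\<^bsub>Loc\<^esub> y = y \<otimes>\<^bsub>Loc\<^esub> x"
    using x y by (simp_all add: Loc_simps m_comm a_comm)
  fix z assume "z \<in> carrier Loc"
  then obtain c u where z: "z = quot c u" "c \<in> carrier R" "u \<in> S" by (rule Loc_cases)
  show "(x \<oplus>\<^bsub>Loc\<^esub> y) \<oplus>\<^bsub>Loc\<^esub> z = x \<oplus>\<^bsub>Loc\<^esub> (y \<oplus>\<^bsub>Loc\<^esub> z)" "(x \<otimes>\<^bsub>Loc\<^esub> y) \<otimes>\<^bsub>Loc\<^esub> z = x \<otimes>\<^bsub>Loc\<^esub> (y \<otimes>\<^bsub>Loc\<^esub> z)"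
    "(x \<oplus>\<^bsub>Loc\<^esub> y) \<otimes>\<^bsub>Loc\<^esub> z = (x \<otimes>\<^bsub>Loc\<^esub> z) \<oplus>\<^bsub>Loc\<^esub> (y \<otimes>\<^bsub>Loc\<^esub> z)"
    using x y z by (simp_all add: Loc_simps r_distr l_distr m_ac a_ac)
qed (simp_all add: Loc_zero_one)

lemma ideal_fractions:
  assumes "ideal I R"
  shows "ideal {quot a s | a s. a \<in> I \<and> s \<in> S} Loc" (is "ideal ?J Loc")
proof -
  interpret I: ideal I R by fact
  interpret Loc: cring Loc by (rule cring_localization)
  have mem: "quot a s \<in> ?J" if "a \<in> I" "s \<in> S" for a s using that by blast
  show ?thesis
  proof (intro idealI Loc.ring_axioms)
    show "subgroup ?J (add_monoid Loc)"
    proof (rule Loc.add.subgroupI)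
      show "?J \<subseteq> carrier Loc" using I.a_subset by (auto intro!: quot_closed)
      show "?J \<noteq> {}" using mem[OF I.zero_closed one_S] by blast
      fix x assume "x \<in> ?J"
      then obtain a s where x: "x = quot a s" "a \<in> I" "s \<in> S" by blast
      have "quot (\<ominus> a) s \<oplus>\<^bsub>Loc\<^esub> x = \<zero>\<^bsub>Loc\<^esub>"
        using x I.Icarr by (simp add: Loc_simps r_minus l_neg)
      then have "\<ominus>\<^bsub>Loc\<^esub> x = quot (\<ominus> a) s"
        using x I.Icarr by (intro Loc.minus_equality) auto
      then show "\<ominus>\<^bsub>Loc\<^esub> x \<in> ?J" using x mem by simp
      fix y assume "y \<in> ?J"
      then obtain b t where y: "y = quot b t" "b \<in> I" "t \<in> S" by blast
      have "t \<otimes> a \<oplus> s \<otimes> b \<in> I" using x y by (intro I.a_closed I.I_l_closed) auto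
      then show "x \<oplus>\<^bsub>Loc\<^esub> y \<in> ?J" using x y I.Icarr mem by (simp add: Loc_simps)
    qed
    fix x y assume "x \<in> ?J" "y \<in> carrier Loc"
    then obtain a s b t where x: "x = quot a s" "a \<in> I" "s \<in> S"
      and y: "y = quot b t" "b \<in> carrier R" "t \<in> S" by (auto simp: carrier_Loc)
    then show "y \<otimes>\<^bsub>Loc\<^esub> x \<in> ?J" "x \<otimes>\<^bsub>Loc\<^esub> y \<in> ?J"
      using I.Icarr I.I_l_closed I.I_r_closed mem by (simp_all add: Loc_simps)
  qed
qed

text \<open>
  The extended ideal consists of the fractions with numerator in \<open>I\<close>: these form an ideal, and
  conversely \<open>f\<close> is the multiple of \<open>s f\<close> by \<open>1 / s\<close>.
\<close>

proposition mem_extended_ideal_iff: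
  assumes "ideal I R" and f: "f \<in> carrier R"
  shows "localization_map R S f \<in> genideal Loc (localization_map R S ` I) \<longleftrightarrow> (\<exists>s\<in>S. s \<otimes> f \<in> I)"
proof -
  interpret I: ideal I R by fact
  interpret Loc: cring Loc by (rule cring_localization)
  let ?\<phi> = "localization_map R S" and ?J = "{quot a s | a s. a \<in> I \<and> s \<in> S}"
  have img: "?\<phi> ` I \<subseteq> carrier Loc" using I.Icarr by (auto simp: localization_map_def)
  show ?thesis
  proof
    assume "?\<phi> f \<in> genideal Loc (?\<phi> ` I)"
    moreover have "genideal Loc (?\<phi> ` I) \<subseteq> ?J"
    proof (rule Loc.genideal_minimal[OF ideal_fractions[OF assms(1)]])
      show "?\<phi> ` I \<subseteq> ?J" using one_S unfolding localization_map_def by blast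
    qed
    ultimately obtain a s where as: "quot f \<one> = quot a s" "a \<in> I" "s \<in> S"
      by (auto simp: localization_map_def)
    then have "s \<otimes> f = a" using f I.Icarr by (simp add: quot_eq_iff)
    then show "\<exists>s\<in>S. s \<otimes> f \<in> I" using as by blast
  next
    assume "\<exists>s\<in>S. s \<otimes> f \<in> I"
    then obtain s where s: "s \<in> S" "s \<otimes> f \<in> I" by blast
    then have "?\<phi> (s \<otimes> f) \<in> genideal Loc (?\<phi> ` I)" using Loc.genideal_self[OF img] by blast
    then have "quot \<one> s \<otimes>\<^bsub>Loc\<^esub> ?\<phi> (s \<otimes> f) \<in> genideal Loc (?\<phi> ` I)"
      using s by (intro ideal.I_l_closed[OF Loc.genideal_ideal[OF img]]) auto
    moreover have "quot \<one> s \<otimes>\<^bsub>Loc\<^esub> ?\<phi> (s \<otimes> f) = ?\<phi> f"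
      using s f by (simp add: localization_map_def Loc_simps)
    ultimately show "?\<phi> f \<in> genideal Loc (?\<phi> ` I)" by simp
  qed
qed

end

lemma (in cring) ideal_power:
  assumes "ideal Q R"
  shows "ideal (Q [^]\<^bsub>ideals_set R\<^esub> (n::nat)) R"
proof -
  interpret monoid "ideals_set R" using ideals_set_is_comm_monoid by (rule comm_monoid.axioms)
  have "Q [^]\<^bsub>ideals_set R\<^esub> n \<in> carrier (ideals_set R)"
    using assms by (intro nat_pow_closed) (simp add: ideals_set_def)
  then show ?thesis by (simp add: ideals_set_def)
qed

lemma ideal_power_0: "Q [^]\<^bsub>ideals_set R\<^esub> (0::nat) = carrier R"
  by (simp add: nat_pow_def ideals_set_def)

lemma ideal_power_Suc: "Q [^]\<^bsub>ideals_set R\<^esub> Suc n = ideal_prod R (Q [^]\<^bsub>ideals_set R\<^esub> n) Q"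
  by (simp add: nat_pow_def ideals_set_def)

lemma (in cring) ideal_power_Suc_subset:
  assumes "ideal Q R"
  shows "Q [^]\<^bsub>ideals_set R\<^esub> Suc n \<subseteq> Q [^]\<^bsub>ideals_set R\<^esub> n \<inter> Q"
  unfolding ideal_power_Suc by (intro ideal_prod_inter ideal_power assms)

lemma (in cring) ideal_power_add:
  assumes "ideal Q R" "x \<in> Q [^]\<^bsub>ideals_set R\<^esub> (m::nat)" "y \<in> Q [^]\<^bsub>ideals_set R\<^esub> (n::nat)"
  shows "x \<otimes> y \<in> Q [^]\<^bsub>ideals_set R\<^esub> (m + n)"
proof -
  interpret monoid "ideals_set R" using ideals_set_is_comm_monoid by (rule comm_monoid.axioms)
  have "Q [^]\<^bsub>ideals_set R\<^esub> (m + n) = ideal_prod R (Q [^]\<^bsub>ideals_set R\<^esub> m) (Q [^]\<^bsub>ideals_set R\<^esub> n)"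
    using nat_pow_mult[of Q m n] assms(1) by (simp add: ideals_set_def)
  then show ?thesis using assms by (simp add: ideal_prod.prod)
qed

proposition mem_symbolic_power_iff:
  assumes "domain R" "primeideal Q R"
  shows "f \<in> symbolic_power R Q n \<longleftrightarrow>
    f \<in> carrier R \<and> (\<exists>s\<in>carrier R - Q. s \<otimes>\<^bsub>R\<^esub> f \<in> Q [^]\<^bsub>ideals_set R\<^esub> n)"
proof -
  interpret domain R by fact
  interpret Q: primeideal Q R by fact
  interpret domain_with_denominators R "carrier R - Q"
    by unfold_locales (use Q.I_prime Q.I_notcarr Q.one_imp_carrier Q.zero_closed in auto)
  show ?thesis
    unfolding symbolic_power_def Let_def
    using mem_extended_ideal_iff[OF ideal_power[OF Q.ideal_axioms]] by auto
qed

lemma diff_ops_hom: "\<delta> \<in> diff_ops A \<phi> R k \<Longrightarrow> \<delta> \<in> hom (add_monoid R) (add_monoid R)"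
  by (cases k) (auto simp: linear_endos_def)

lemma
  assumes "\<delta> \<in> diff_ops A \<phi> R k"
  shows diff_ops_closed: "x \<in> carrier R \<Longrightarrow> \<delta> x \<in> carrier R"
    and diff_ops_add: "x \<in> carrier R \<Longrightarrow> y \<in> carrier R \<Longrightarrow> \<delta> (x \<oplus>\<^bsub>R\<^esub> y) = \<delta> x \<oplus>\<^bsub>R\<^esub> \<delta> y"
  using diff_ops_hom[OF assms] by (auto simp: hom_def Pi_iff)

text \<open>
  By induction on the order: for \<open>q \<in> Q\<close> and \<open>g \<in> Q\<^sup>k\<close> the value \<open>\<delta> (q g)\<close> differs from
  \<open>q \<delta> g \<in> Q\<close> by the commutator of \<open>\<delta>\<close> and \<open>q\<close> at \<open>g\<close>, to which the induction hypothesis applies.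
\<close>

lemma (in cring) diff_ops_ideal_power:
  assumes Q: "ideal Q R" and "\<delta> \<in> diff_ops A \<phi> R k" "f \<in> Q [^]\<^bsub>ideals_set R\<^esub> Suc k"
  shows "\<delta> f \<in> Q"
  using assms(2,3)
proof (induction k arbitrary: \<delta> f)
  case 0
  interpret Q: ideal Q R by fact
  have f: "f \<in> Q" using ideal_power_Suc_subset[OF Q, of 0] 0(2) by blast
  have "\<delta> (f \<otimes> \<one>) = f \<otimes> \<delta> \<one>" using 0(1) Q.Icarr[OF f] one_closed by (auto simp: linear_endos_def simp del: r_one)
  then show ?case using f Q.Icarr diff_ops_closed[OF 0(1)] Q.I_r_closed by simp
next
  case (Suc k)
  interpret Q: ideal Q R by fact
  interpret Qk: ideal "Q [^]\<^bsub>ideals_set R\<^esub> Suc k" R by (rule ideal_power[OF Q])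
  note closed = diff_ops_closed[OF Suc.prems(1)] and add = diff_ops_add[OF Suc.prems(1)]
  have "f \<in> carrier R \<and> \<delta> f \<in> Q"
    using Suc.prems(2) unfolding ideal_power_Suc[of R Q "Suc k"]
  proof (induction f rule: ideal_prod.induct)
    case (prod g q)
    then have cl: "g \<in> carrier R" "q \<in> carrier R" using Qk.Icarr Q.Icarr by auto
    have "(\<lambda>x. \<delta> (q \<otimes> x) \<ominus> q \<otimes> \<delta> x) \<in> diff_ops A \<phi> R k" using Suc.prems(1) cl by simp
    then have "\<delta> (q \<otimes> g) \<ominus> q \<otimes> \<delta> g \<in> Q" using Suc.IH prod(1) by blast
    moreover have "q \<otimes> \<delta> g \<in> Q" using prod(2) closed cl Q.I_r_closed by blast
    ultimately have "(\<delta> (q \<otimes> g) \<ominus> q \<otimes> \<delta> g) \<oplus> q \<otimes> \<delta> g \<in> Q" by (rule Q.a_closed)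
    then show ?case using cl closed by (simp add: a_minus_def a_assoc l_neg m_comm)
  next
    case (sum g h)
    then show ?case using add Q.a_closed by auto
  qed
  then show ?case by blast
qed

text \<open>
  If \<open>s f \<in> Q\<^sup>k\<^sup>+\<^sup>1\<close> with \<open>s \<notin> Q\<close>, then modulo \<open>Q\<close> the element \<open>s \<delta> f\<close> agrees with
  \<open>\<delta> (s f) \<in> Q\<close>: the commutator of \<open>\<delta>\<close> and \<open>s\<close> has smaller order, so it maps \<open>f\<close> into \<open>Q\<close> by
  induction.
\<close>

proposition diff_ops_symbolic_power:
  assumes R: "domain R" and Q: "primeideal Q R"
    and "\<delta> \<in> diff_ops A \<phi> R k" "f \<in> symbolic_power R Q (Suc k)"
  shows "\<delta> f \<in> Q"
proof -
  interpret domain R by fact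
  interpret Q: primeideal Q R by fact
  have f: "f \<in> carrier R" and "\<exists>s\<in>carrier R - Q. s \<otimes>\<^bsub>R\<^esub> f \<in> Q [^]\<^bsub>ideals_set R\<^esub> Suc k"
    using assms(4) mem_symbolic_power_iff[OF R Q] by auto
  then obtain s where s: "s \<in> carrier R" "s \<notin> Q" "s \<otimes>\<^bsub>R\<^esub> f \<in> Q [^]\<^bsub>ideals_set R\<^esub> Suc k" by blast
  show ?thesis
    using assms(3) s(3)
  proof (induction k arbitrary: \<delta>)
    case 0
    have "\<delta> (s \<otimes>\<^bsub>R\<^esub> f) = s \<otimes>\<^bsub>R\<^esub> \<delta> f" using 0(1) s f by (simp add: linear_endos_def)
    moreover have "\<delta> (s \<otimes>\<^bsub>R\<^esub> f) \<in> Q" using diff_ops_ideal_power[OF Q.ideal_axioms 0] .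
    ultimately show ?case using Q.I_prime[of s "\<delta> f"] s diff_ops_closed[OF 0(1) f] by auto
  next
    case (Suc k)
    note closed = diff_ops_closed[OF Suc.prems(1)]
    have "(\<lambda>x. \<delta> (s \<otimes>\<^bsub>R\<^esub> x) \<ominus>\<^bsub>R\<^esub> s \<otimes>\<^bsub>R\<^esub> \<delta> x) \<in> diff_ops A \<phi> R k" using Suc.prems(1) s by simp
    then have "\<delta> (s \<otimes>\<^bsub>R\<^esub> f) \<ominus>\<^bsub>R\<^esub> s \<otimes>\<^bsub>R\<^esub> \<delta> f \<in> Q"
      using Suc.IH Suc.prems(2) ideal_power_Suc_subset[OF Q.ideal_axioms, of "Suc k"] by blast
    moreover have "\<delta> (s \<otimes>\<^bsub>R\<^esub> f) \<in> Q" using diff_ops_ideal_power[OF Q.ideal_axioms Suc.prems] .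
    ultimately have "\<delta> (s \<otimes>\<^bsub>R\<^esub> f) \<ominus>\<^bsub>R\<^esub> (\<delta> (s \<otimes>\<^bsub>R\<^esub> f) \<ominus>\<^bsub>R\<^esub> s \<otimes>\<^bsub>R\<^esub> \<delta> f) \<in> Q"
      by (simp add: a_minus_def Q.a_closed Q.a_inv_closed)
    then have "s \<otimes>\<^bsub>R\<^esub> \<delta> f \<in> Q"
      using s f closed by (simp add: a_minus_def minus_add a_assoc[symmetric] r_neg)
    then show ?case using Q.I_prime[of s "\<delta> f"] s closed[OF f] by auto
  qed
qed

section \<open>Subrings and polynomials with restricted coefficients\<close>

text \<open>
  The coefficient fields below are subsets of one ambient type, constructed by Zorn's lemma; the
  type class operations keep the polynomial arithmetic over them within the type \<open>'a poly\<close>.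
\<close>

definition is_subring :: "'a::comm_ring_1 set \<Rightarrow> bool" where
  "is_subring L \<longleftrightarrow> 1 \<in> L \<and> (\<forall>x\<in>L. \<forall>y\<in>L. x - y \<in> L \<and> x * y \<in> L)"

lemma
  assumes "is_subring L"
  shows subring_one: "1 \<in> L" and subring_zero: "0 \<in> L"
    and subring_diff: "x \<in> L \<Longrightarrow> y \<in> L \<Longrightarrow> x - y \<in> L"
    and subring_mult: "x \<in> L \<Longrightarrow> y \<in> L \<Longrightarrow> x * y \<in> L"
    and subring_uminus: "x \<in> L \<Longrightarrow> - x \<in> L"
    and subring_add: "x \<in> L \<Longrightarrow> y \<in> L \<Longrightarrow> x + y \<in> L"
    and subring_power: "x \<in> L \<Longrightarrow> x ^ k \<in> L"
    and subring_of_nat: "of_nat k \<in> L"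
    and subring_sum: "(\<And>i. i \<in> A \<Longrightarrow> f i \<in> L) \<Longrightarrow> sum f A \<in> L"
proof -
  show one: "1 \<in> L" and diff: "x \<in> L \<Longrightarrow> y \<in> L \<Longrightarrow> x - y \<in> L"
    and mult: "x \<in> L \<Longrightarrow> y \<in> L \<Longrightarrow> x * y \<in> L" for x y
    using assms by (auto simp: is_subring_def)
  show zero: "0 \<in> L" using diff[OF one one] by simp
  show um: "x \<in> L \<Longrightarrow> - x \<in> L" for x using diff[OF zero] by fastforce
  show add: "x \<in> L \<Longrightarrow> y \<in> L \<Longrightarrow> x + y \<in> L" for x y
    using diff[of x "- y"] um[of y] by simp
  show "x \<in> L \<Longrightarrow> x ^ k \<in> L" by (induction k) (auto intro: one mult)
  show "of_nat k \<in> L" by (induction k) (auto intro: zero one add)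
  show "(\<And>i. i \<in> A \<Longrightarrow> f i \<in> L) \<Longrightarrow> sum f A \<in> L"
    by (induction A rule: infinite_finite_induct) (auto intro: zero add)
qed

lemmas subring_closed = subring_one subring_zero subring_diff subring_mult subring_uminus
  subring_add subring_power subring_of_nat subring_sum

definition coeffs_in :: "'a::zero set \<Rightarrow> 'a poly \<Rightarrow> bool" where
  "coeffs_in L h \<longleftrightarrow> (\<forall>i. Polynomial.coeff h i \<in> L)"

lemma coeffs_in_pCons: "coeffs_in L (pCons a h) \<longleftrightarrow> a \<in> L \<and> coeffs_in L h"
  by (auto simp: coeffs_in_def coeff_pCons split: nat.splits)

lemma
  assumes "is_subring L"
  shows coeffs_in_zero: "coeffs_in L 0"
    and coeffs_in_add: "coeffs_in L g \<Longrightarrow> coeffs_in L h \<Longrightarrow> coeffs_in L (g + h)"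
    and coeffs_in_diff: "coeffs_in L g \<Longrightarrow> coeffs_in L h \<Longrightarrow> coeffs_in L (g - h)"
    and coeffs_in_mult: "coeffs_in L g \<Longrightarrow> coeffs_in L h \<Longrightarrow> coeffs_in L (g * h)"
    and coeffs_in_monom: "c \<in> L \<Longrightarrow> coeffs_in L (Polynomial.monom c k)"
    and coeffs_in_pderiv: "coeffs_in L g \<Longrightarrow> coeffs_in L (pderiv g)"
  using assms by (auto simp: coeffs_in_def coeff_mult coeff_pderiv
      intro!: subring_closed subring_mult[OF _ subring_of_nat] subring_add[OF _ subring_one])

lemma poly_in_subring:
  assumes "is_subring L" "coeffs_in L h" "x \<in> L"
  shows "poly h x \<in> L"
  using assms by (auto simp: poly_altdef coeffs_in_def intro!: subring_sum subring_mult subring_power)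

lemma poly_coeffs_in_ideal:
  assumes "is_subring C" "0 \<in> I" "\<And>x y. x \<in> I \<Longrightarrow> y \<in> I \<Longrightarrow> x + y \<in> I"
    and "\<And>c x. c \<in> C \<Longrightarrow> x \<in> I \<Longrightarrow> c * x \<in> I"
    and "coeffs_in I h" "x \<in> C"
  shows "poly h x \<in> I"
  using assms(5)
proof (induction h)
  case (pCons a p)
  then show ?case using assms by (auto simp: coeffs_in_pCons)
qed (use assms in auto)

text \<open>
  The second-order Taylor formula with a remainder in the subring; it is the Newton step when
  \<open>y\<^sup>2\<close> is negligible.
\<close>

lemma poly_taylor2:
  assumes C: "is_subring C" and "coeffs_in C h" "x \<in> C" "y \<in> C"
  shows "\<exists>e\<in>C. poly h (x + y) = poly h x + poly (pderiv h) x * y + y\<^sup>2 * e"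
  using assms(2)
proof (induction h)
  case 0
  then show ?case using subring_zero[OF C] by auto
next
  case (pCons a p)
  then obtain e where e: "e \<in> C" "poly p (x + y) = poly p x + poly (pderiv p) x * y + y\<^sup>2 * e"
    and p: "coeffs_in C p" by (auto simp: coeffs_in_pCons)
  let ?e = "(x + y) * e + poly (pderiv p) x"
  have "?e \<in> C"
    using assms e p by (intro subring_closed[OF C] poly_in_subring coeffs_in_pderiv) auto
  moreover have "poly (pCons a p) (x + y) =
      poly (pCons a p) x + poly (pderiv (pCons a p)) x * y + y\<^sup>2 * ?e"
    by (simp add: e(2) pderiv_pCons algebra_simps power2_eq_square)
  ultimately show ?case by blast
qed

lemma coeffs_in_monic_division:
  fixes g h :: "'a::idom poly"
  assumes L: "is_subring L" and g: "coeffs_in L g" "lead_coeff g = 1" "Polynomial.degree g > 0"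
    and h: "coeffs_in L h"
  shows "\<exists>q r. coeffs_in L q \<and> coeffs_in L r \<and> h = q * g + r \<and> Polynomial.degree r < Polynomial.degree g"
  using h
proof (induction "Polynomial.degree h" arbitrary: h rule: less_induct)
  case less
  show ?case
  proof (cases "Polynomial.degree h < Polynomial.degree g")
    case True
    then show ?thesis using less.prems coeffs_in_zero[OF L] by (intro exI[of _ 0] exI[of _ h]) auto
  next
    case False
    define t where "t = Polynomial.monom (lead_coeff h) (Polynomial.degree h - Polynomial.degree g)"
    have t: "coeffs_in L t"
      using less.prems unfolding t_def by (intro coeffs_in_monom L) (auto simp: coeffs_in_def)
    have "Polynomial.degree (t * g) \<le> Polynomial.degree h"
      using False degree_mult_le[of t g] degree_monom_le[of "lead_coeff h" "Polynomial.degree h - Polynomial.degree g"]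
      unfolding t_def by linarith
    moreover have "Polynomial.coeff (t * g) (Polynomial.degree h) = lead_coeff h"
      using False g(2) by (simp add: t_def coeff_monom_mult not_less)
    ultimately have "Polynomial.coeff (h - t * g) i = 0" if "i \<ge> Polynomial.degree h" for i
      using that coeff_eq_0[of h i] coeff_eq_0[of "t * g" i] by (cases "i = Polynomial.degree h") auto
    then have "Polynomial.degree (h - t * g) < Polynomial.degree h"
      by (metis False degree_0 g(3) leading_coeff_0_iff
          order.strict_trans2 linorder_le_less_linear)
    then obtain q r where "coeffs_in L q" "coeffs_in L r" "h - t * g = q * g + r"
      "Polynomial.degree r < Polynomial.degree g"
      using less.hyps[of "h - t * g"] less.prems t g(1) L by (metis coeffs_in_diff coeffs_in_mult)
    moreover from this have "h = (t + q) * g + r" by (simp add: algebra_simps)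
    ultimately show ?thesis using t coeffs_in_add[OF L] by blast
  qed
qed

section \<open>Coefficient fields along square-zero thickenings\<close>

lemma Union_chain_pair:
  assumes "subset.chain A \<C>" "x \<in> \<Union>\<C>" "y \<in> \<Union>\<C>"
  obtains Z where "Z \<in> \<C>" "x \<in> Z" "y \<in> Z"
proof -
  obtain Z Y where "Z \<in> \<C>" "Y \<in> \<C>" "x \<in> Z" "y \<in> Y" using assms by blast
  moreover have "Z \<subseteq> Y \<or> Y \<subseteq> Z"
    using assms(1) \<open>Z \<in> \<C>\<close> \<open>Y \<in> \<C>\<close> by (auto simp: subset_chain_def)
  ultimately show thesis using that by blast
qed

text \<open>
  The quotient \<open>C / I\<close> is a local ring with maximal ideal \<open>N / I\<close> of square zero. The last
  condition says that the residue field \<open>C / N\<close> has the same characteristic as \<open>C\<close>; for instance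
  it fails for the thickening of the field with \<open>p\<close> elements by the integers modulo \<open>p\<^sup>2\<close>, which has
  no coefficient field.
\<close>

locale square_zero_thickening =
  fixes C N I :: "'a::idom set"
  assumes subring_C: "is_subring C"
    and N_C: "N \<subseteq> C" and I_N: "I \<subseteq> N" and zero_I: "0 \<in> I"
    and N_diff: "x \<in> N \<Longrightarrow> y \<in> N \<Longrightarrow> x - y \<in> N"
    and I_diff: "x \<in> I \<Longrightarrow> y \<in> I \<Longrightarrow> x - y \<in> I"
    and N_mult: "c \<in> C \<Longrightarrow> x \<in> N \<Longrightarrow> c * x \<in> N"
    and I_mult: "c \<in> C \<Longrightarrow> x \<in> I \<Longrightarrow> c * x \<in> I"
    and N_square: "x \<in> N \<Longrightarrow> y \<in> N \<Longrightarrow> x * y \<in> I"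
    and one_N: "1 \<notin> N"
    and N_maximal: "x \<in> C \<Longrightarrow> x \<notin> N \<Longrightarrow> \<exists>y\<in>C. x * y - 1 \<in> N"
    and of_nat_N: "of_nat r \<in> N \<Longrightarrow> CHAR('a) dvd r"
begin

lemmas C_closed = subring_closed[OF subring_C]

lemma zero_N: "0 \<in> N" using zero_I I_N by blast
lemma N_uminus: "x \<in> N \<Longrightarrow> - x \<in> N" using N_diff[OF zero_N] by fastforce
lemma I_uminus: "x \<in> I \<Longrightarrow> - x \<in> I" using I_diff[OF zero_I] by fastforce
lemma N_add: "x \<in> N \<Longrightarrow> y \<in> N \<Longrightarrow> x + y \<in> N" using N_diff[of x "- y"] N_uminus[of y] by simp
lemma I_add: "x \<in> I \<Longrightarrow> y \<in> I \<Longrightarrow> x + y \<in> I" using I_diff[of x "- y"] I_uminus[of y] by simp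

lemma N_prime:
  assumes "x \<in> C" "y \<in> C" "x * y \<in> N" "x \<notin> N"
  shows "y \<in> N"
proof -
  obtain z where z: "z \<in> C" "x * z - 1 \<in> N" using N_maximal assms by blast
  have "z * (x * y) - y * (x * z - 1) \<in> N"
    by (rule N_diff[OF N_mult[OF z(1) assms(3)] N_mult[OF assms(2) z(2)]])
  then show ?thesis by (simp add: algebra_simps)
qed

lemma inverse_mod_I:
  assumes "x \<in> C" "x \<notin> N"
  obtains y where "y \<in> C" "x * y - 1 \<in> I"
proof -
  obtain z where z: "z \<in> C" "x * z - 1 \<in> N" using N_maximal assms by blast
  have "- ((x * z - 1) * (x * z - 1)) \<in> I" using z by (intro I_uminus N_square)
  moreover have "x * (z * (2 - x * z)) - 1 = - ((x * z - 1) * (x * z - 1))"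
    by (simp add: algebra_simps)
  moreover have "z * (2 - x * z) \<in> C"
    using z(1) assms(1) C_closed(8)[of 2] by (intro C_closed) auto
  ultimately show thesis using that by metis
qed

text \<open>
  A subring that meets \<open>N\<close> only in \<open>I\<close> maps injectively into \<open>C / N\<close> modulo \<open>I\<close>, so it is the
  image of a section of \<open>C / I \<rightarrow> C / N\<close> over a subring of the residue field. In characteristic
  \<open>p\<close> the section is forced on \<open>p\<close>-th powers: if \<open>x\<close> and \<open>x'\<close> agree modulo \<open>N\<close>, then \<open>x\<^sup>p\<close> and
  \<open>x'\<^sup>p\<close> agree modulo \<open>I\<close>. These powers are therefore required from the start, which makes every
  later extension by a non-separable element unobstructed. In characteristic zero the exponent
  is \<open>0\<close> and the condition only says \<open>1 \<in> L\<close>.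
\<close>

definition partial_section :: "'a set \<Rightarrow> bool" where
  "partial_section L \<longleftrightarrow> is_subring L \<and> I \<subseteq> L \<and> L \<subseteq> C \<and> L \<inter> N \<subseteq> I \<and> (\<forall>x\<in>C. x ^ CHAR('a) \<in> L)"

text \<open>
  The starting point for Zorn's lemma is the prime ring in characteristic zero and the ring
  of \<open>p\<close>-th powers in characteristic \<open>p\<close>, each enlarged by \<open>I\<close>.
\<close>

lemma ex_partial_section: "\<exists>L. partial_section L"
proof (cases "CHAR('a) = 0")
  case True
  define L where "L = {of_int k + i | k i. i \<in> I}"
  have mem: "of_int k + i \<in> L" if "i \<in> I" for k i using that by (auto simp: L_def)
  have int_C: "of_int k \<in> C" for k
    by (cases k rule: int_cases2) (use C_closed(5,8) in auto)
  have "is_subring L"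
    unfolding is_subring_def
  proof (intro conjI ballI)
    show "1 \<in> L" using mem[OF zero_I, of 1] by simp
    fix x y assume "x \<in> L" "y \<in> L"
    then obtain k i l j where x: "x = of_int k + i" "i \<in> I" and y: "y = of_int l + j" "j \<in> I"
      by (auto simp: L_def)
    have "of_int (k - l) + (i - j) \<in> L" using x y I_diff by (intro mem) auto
    then show "x - y \<in> L" by (simp add: x y algebra_simps)
    have "i \<in> C" using x I_N N_C by blast
    then have "of_int (k * l) + (of_int k * j + of_int l * i + i * j) \<in> L"
      using x y int_C by (intro mem I_add I_mult) auto
    then show "x * y \<in> L" by (simp add: x y algebra_simps)
  qed
  moreover have "I \<subseteq> L" using mem[of _ 0] by auto
  moreover have "L \<subseteq> C" using int_C I_N N_C C_closed(6) by (auto simp: L_def)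
  moreover have "x \<in> I" if "x \<in> L" "x \<in> N" for x
  proof -
    obtain k i where x: "x = of_int k + i" "i \<in> I" using \<open>x \<in> L\<close> by (auto simp: L_def)
    then have k: "of_int k \<in> N" using N_diff[OF \<open>x \<in> N\<close>, of i] I_N by auto
    have "k = 0"
    proof (cases k rule: int_cases2)
      case (nonneg n)
      then show ?thesis using of_nat_N[of n] k True by simp
    next
      case (nonpos n)
      then show ?thesis using of_nat_N[of n] N_uminus[OF k] True by simp
    qed
    then show ?thesis using x by simp
  qed
  moreover have "x ^ CHAR('a) \<in> L" for x using True mem[OF zero_I, of 1] by simp
  ultimately show ?thesis unfolding partial_section_def by blast
next
  case False
  define p where "p = CHAR('a)"
  have p: "Factorial_Ring.prime p" using prime_CHAR_semidom[where 'a='a] False by (auto simp: p_def)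
  have frob: "(x - y) ^ p = x ^ p - y ^ p" for x y :: 'a
    using freshmans_dream[of p x "- y"] p minus_power_prime_CHAR[of p y] by (simp add: p_def)
  have p2: "p = Suc (Suc (p - 2))" using prime_ge_2_nat[OF p] by simp
  define L where "L = {c ^ p + i | c i. c \<in> C \<and> i \<in> I}"
  have mem: "c ^ p + i \<in> L" if "c \<in> C" "i \<in> I" for c i using that by (auto simp: L_def)
  have "is_subring L"
    unfolding is_subring_def
  proof (intro conjI ballI)
    show "1 \<in> L" using mem[of 1 0] C_closed(1) zero_I by simp
    fix x y assume "x \<in> L" "y \<in> L"
    then obtain k i l j where x: "x = k ^ p + i" "i \<in> I" "k \<in> C" and y: "y = l ^ p + j" "j \<in> I" "l \<in> C"
      by (auto simp: L_def)
    have "(k - l) ^ p + (i - j) \<in> L" using x y I_diff C_closed(3) by (intro mem) auto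
    then show "x - y \<in> L" by (simp add: x y frob algebra_simps)
    have "i \<in> C" using x I_N N_C by blast
    then have "(k * l) ^ p + (k ^ p * j + l ^ p * i + i * j) \<in> L"
      using x y by (intro mem I_add I_mult C_closed) auto
    then show "x * y \<in> L" by (simp add: x y algebra_simps)
  qed
  moreover have "I \<subseteq> L" using mem[of 0] C_closed(2) p2 by (auto simp: power_0_left)
  moreover have "L \<subseteq> C" using I_N N_C by (auto simp: L_def intro!: C_closed)
  moreover have "x \<in> I" if "x \<in> L" "x \<in> N" for x
  proof -
    obtain k i where x: "x = k ^ p + i" "i \<in> I" "k \<in> C" using \<open>x \<in> L\<close> by (auto simp: L_def)
    then have k: "k ^ p \<in> N" using N_diff[OF \<open>x \<in> N\<close>, of i] I_N by auto
    have "k \<in> N"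
    proof (rule ccontr)
      assume "k \<notin> N"
      have "k ^ n \<notin> N" for n
        by (induction n) (use one_N N_prime[OF \<open>k \<in> C\<close> C_closed(7)[OF \<open>k \<in> C\<close>]] \<open>k \<notin> N\<close> in auto)
      then show False using k by blast
    qed
    have "k ^ p = k ^ (p - 2) * (k * k)" by (subst p2) (simp add: algebra_simps)
    then have "k ^ p \<in> I"
      using I_mult[OF C_closed(7)[OF \<open>k \<in> C\<close>] N_square[OF \<open>k \<in> N\<close> \<open>k \<in> N\<close>]] by simp
    then show ?thesis using x I_add by simp
  qed
  moreover have "x ^ CHAR('a) \<in> L" if "x \<in> C" for x using mem[OF that zero_I] by (simp add: p_def)
  ultimately show ?thesis unfolding partial_section_def by blast
qed

lemma ex_maximal_partial_section:
  obtains L where "partial_section L" "\<And>L'. partial_section L' \<Longrightarrow> L \<subseteq> L' \<Longrightarrow> L' = L"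
proof -
  have "\<exists>L\<in>Collect partial_section. \<forall>Z\<in>Collect partial_section. L \<subseteq> Z \<longrightarrow> Z = L"
  proof (rule subset_Zorn_nonempty)
    show "Collect partial_section \<noteq> {}" using ex_partial_section by auto
    fix \<C> assume ne: "\<C> \<noteq> {}" and ch: "subset.chain (Collect partial_section) \<C>"
    have ps: "partial_section Z" if "Z \<in> \<C>" for Z using ch that by (auto simp: subset_chain_def)
    obtain Z0 where Z0: "Z0 \<in> \<C>" using ne by blast
    have "is_subring (\<Union>\<C>)"
      unfolding is_subring_def
    proof (intro conjI ballI)
      show "1 \<in> \<Union>\<C>" using ps[OF Z0] Z0 subring_one by (auto simp: partial_section_def)
      fix x y assume "x \<in> \<Union>\<C>" "y \<in> \<Union>\<C>"
      then obtain Z where Z: "Z \<in> \<C>" "x \<in> Z" "y \<in> Z" by (rule Union_chain_pair[OF ch])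
      have "is_subring Z" using ps[OF Z(1)] by (simp add: partial_section_def)
      then show "x - y \<in> \<Union>\<C>" "x * y \<in> \<Union>\<C>"
        using Z subring_diff[of Z x y] subring_mult[of Z x y] by auto
    qed
    then show "\<Union>\<C> \<in> Collect partial_section"
      using ps Z0 unfolding partial_section_def by blast
  qed
  then show thesis using that by auto
qed

text \<open>
  The elements of \<open>C\<close> that are fractions over \<open>L\<close> form a partial section too. So a maximal \<open>L\<close> is
  a field modulo \<open>I\<close>.
\<close>

lemma maximal_partial_section_inverse:
  assumes L: "partial_section L" "\<And>L'. partial_section L' \<Longrightarrow> L \<subseteq> L' \<Longrightarrow> L' = L"
    and u: "u \<in> L" "u \<notin> N"
  obtains v where "v \<in> L" "u * v - 1 \<in> I"
proof -
  have sub: "is_subring L" and "I \<subseteq> L" "L \<subseteq> C" and LN: "L \<inter> N \<subseteq> I" and pow: "\<forall>x\<in>C. x ^ CHAR('a) \<in> L"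
    using L(1) by (auto simp: partial_section_def)
  note L_closed = subring_closed[OF sub]
  define L' where "L' = {x \<in> C. \<exists>w\<in>L - N. w * x \<in> L}"
  have "1 \<in> L - N" using one_N L_closed(1) by blast
  then have LL': "L \<subseteq> L'" using \<open>L \<subseteq> C\<close> by (force simp: L'_def)
  have "partial_section L'"
    unfolding partial_section_def is_subring_def
  proof (intro conjI ballI)
    show "1 \<in> L'" using LL' L_closed by blast
    show "I \<subseteq> L'" using LL' \<open>I \<subseteq> L\<close> by blast
    show "L' \<subseteq> C" by (auto simp: L'_def)
    show "L' \<inter> N \<subseteq> I"
    proof
      fix x assume "x \<in> L' \<inter> N"
      then obtain w where w: "w \<in> L" "w \<notin> N" "w * x \<in> L" "x \<in> N" "x \<in> C" by (auto simp: L'_def)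
      then have "w * x \<in> I" using LN N_mult \<open>L \<subseteq> C\<close> by blast
      obtain v where v: "v \<in> C" "w * v - 1 \<in> I" using inverse_mod_I w \<open>L \<subseteq> C\<close> by blast
      have "v * (w * x) - x * (w * v - 1) \<in> I"
        by (rule I_diff[OF I_mult[OF v(1) \<open>w * x \<in> I\<close>] I_mult[OF w(5) v(2)]])
      then show "x \<in> I" by (simp add: algebra_simps)
    qed
    fix x y assume "x \<in> L'" "y \<in> L'"
    then obtain a b where ab: "x \<in> C" "y \<in> C" "a \<in> L" "a \<notin> N" "a * x \<in> L" "b \<in> L" "b \<notin> N" "b * y \<in> L"
      by (auto simp: L'_def)
    then have ab': "a * b \<in> L - N" using N_prime[of a b] \<open>L \<subseteq> C\<close> L_closed(4) by blast
    have "b * (a * x) - a * (b * y) \<in> L" "(a * x) * (b * y) \<in> L" using ab by (auto intro!: L_closed(3,4))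
    then have "(a * b) * (x - y) \<in> L" "(a * b) * (x * y) \<in> L" by (simp_all add: algebra_simps)
    then show "x - y \<in> L'" "x * y \<in> L'" using ab' ab by (auto simp: L'_def intro!: C_closed)
  next
    fix x assume "x \<in> C"
    then show "x ^ CHAR('a) \<in> L'" using pow LL' by blast
  qed
  then have "L' = L" using L(2) LL' by blast
  obtain v where v: "v \<in> C" "u * v - 1 \<in> I" using inverse_mod_I u \<open>L \<subseteq> C\<close> by blast
  then have "u * v \<in> L" using \<open>I \<subseteq> L\<close> L_closed(6)[of "u * v - 1" 1] L_closed(1) by auto
  then have "v \<in> L" using v u \<open>L' = L\<close> by (auto simp: L'_def)
  then show thesis using v that by blast
qed

text \<open>
  The hypothesis says precisely that \<open>L[b]\<close> still meets \<open>N\<close> only in \<open>I\<close>.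
\<close>

lemma maximal_partial_section_adjoin:
  assumes L: "partial_section L" "\<And>L'. partial_section L' \<Longrightarrow> L \<subseteq> L' \<Longrightarrow> L' = L"
    and b: "b \<in> C" "\<And>h. coeffs_in L h \<Longrightarrow> poly h b \<in> N \<Longrightarrow> poly h b \<in> I"
  shows "b \<in> L"
proof -
  have sub: "is_subring L" and "I \<subseteq> L" "L \<subseteq> C" and LN: "L \<inter> N \<subseteq> I" and pow: "\<forall>x\<in>C. x ^ CHAR('a) \<in> L"
    using L(1) by (auto simp: partial_section_def)
  note L_closed = subring_closed[OF sub]
  define L' where "L' = {poly h b | h. coeffs_in L h}"
  have mem: "poly h b \<in> L'" if "coeffs_in L h" for h using that by (auto simp: L'_def)
  have LL': "L \<subseteq> L'"
  proof
    fix x assume "x \<in> L"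
    then show "x \<in> L'" using mem[of "[:x:]"] L_closed(2) by (auto simp: coeffs_in_pCons coeffs_in_zero[OF sub])
  qed
  have "partial_section L'"
    unfolding partial_section_def is_subring_def
  proof (intro conjI ballI)
    show "1 \<in> L'" using LL' L_closed by blast
    show "I \<subseteq> L'" using LL' \<open>I \<subseteq> L\<close> by blast
    show "L' \<subseteq> C"
      using b(1) \<open>L \<subseteq> C\<close> by (force simp: L'_def coeffs_in_def intro!: poly_in_subring[OF subring_C])
    show "L' \<inter> N \<subseteq> I" using b(2) by (auto simp: L'_def)
    fix x y assume "x \<in> L'" "y \<in> L'"
    then obtain g h where gh: "x = poly g b" "y = poly h b" "coeffs_in L g" "coeffs_in L h"
      by (auto simp: L'_def)
    then show "x - y \<in> L'" "x * y \<in> L'"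
      using mem[OF coeffs_in_diff[OF sub gh(3,4)]] mem[OF coeffs_in_mult[OF sub gh(3,4)]] by auto
  next
    fix x assume "x \<in> C"
    then show "x ^ CHAR('a) \<in> L'" using pow LL' by blast
  qed
  then have "L' = L" using L(2) LL' by blast
  moreover have "b \<in> L'"
    using mem[of "[:0, 1:]"] L_closed(1,2) by (auto simp: coeffs_in_pCons coeffs_in_zero[OF sub])
  ultimately show ?thesis by blast
qed

text \<open>
  Modulo \<open>N\<close> the subring \<open>L\<close> is a field, so a polynomial that does not vanish modulo \<open>N\<close> can be
  normalized: drop the coefficients in \<open>N\<close> above the highest one outside \<open>N\<close>, and divide by that
  one.
\<close>

lemma maximal_partial_section_monic:
  assumes L: "partial_section L" "\<And>L'. partial_section L' \<Longrightarrow> L \<subseteq> L' \<Longrightarrow> L' = L"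
    and b: "b \<in> C" and h: "coeffs_in L h" "poly h b \<in> N" "Polynomial.coeff h i \<notin> N"
  obtains g where "coeffs_in L g" "lead_coeff g = 1" "poly g b \<in> N"
    "Polynomial.degree g \<le> Polynomial.degree h"
proof -
  have sub: "is_subring L" and "I \<subseteq> L" "L \<subseteq> C" 
    using L(1) by (auto simp: partial_section_def)
  define J where "J = {i. Polynomial.coeff h i \<notin> N}"
  have Jd: "J \<subseteq> {..Polynomial.degree h}"
  proof
    fix j assume "j \<in> J"
    then have "Polynomial.coeff h j \<noteq> 0" using zero_N by (auto simp: J_def)
    then show "j \<in> {..Polynomial.degree h}" by (simp add: le_degree)
  qed
  have J: "finite J" "J \<noteq> {}" using finite_subset[OF Jd] h(3) by (auto simp: J_def)
  define k where "k = Max J"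
  have k: "k \<in> J" using Max_in[OF J] by (simp add: k_def)
  have kmax: "Polynomial.coeff h j \<in> N" if "j > k" for j
    using that Max_ge[OF J(1), of j] by (auto simp: k_def J_def)
  obtain v where v: "v \<in> L" "Polynomial.coeff h k * v - 1 \<in> I"
    using maximal_partial_section_inverse[OF L] k h(1) by (auto simp: J_def coeffs_in_def)
  define g where "g = Polynomial.monom 1 k + (\<Sum>j<k. Polynomial.monom (v * Polynomial.coeff h j) j)"
  have cg: "Polynomial.coeff g j = (if j = k then 1 else if j < k then v * Polynomial.coeff h j else 0)" for j
    by (auto simp: g_def coeff_sum)
  have dg: "Polynomial.degree g = k"
    by (rule antisym[OF degree_le le_degree]) (auto simp: cg)
  have "coeffs_in L g"
    using v h(1) by (auto simp: coeffs_in_def cg intro!: subring_closed[OF sub])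
  moreover have "lead_coeff g = 1" by (simp add: dg cg)
  moreover have "poly g b \<in> N"
  proof -
    have "coeffs_in N (g - Polynomial.smult v h)"
      unfolding coeffs_in_def
    proof
      fix j
      have vN: "v * x \<in> N" if "x \<in> N" for x using that v(1) \<open>L \<subseteq> C\<close> N_mult by blast
      have "- (Polynomial.coeff h k * v - 1) \<in> N" using v I_N N_uminus by blast
      then show "Polynomial.coeff (g - Polynomial.smult v h) j \<in> N"
        using zero_N N_uminus[OF vN[OF kmax]] by (auto simp: cg mult.commute)
    qed
    then have "poly (g - Polynomial.smult v h) b \<in> N"
      by (intro poly_coeffs_in_ideal[OF subring_C zero_N N_add N_mult]) (use b in auto)
    moreover have "v * poly h b \<in> N" using v(1) h(2) \<open>L \<subseteq> C\<close> N_mult by blast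
    ultimately have "poly (g - Polynomial.smult v h) b + v * poly h b \<in> N" by (rule N_add)
    then show ?thesis by simp
  qed
  moreover have "Polynomial.degree g \<le> Polynomial.degree h" using k Jd dg by auto
  ultimately show thesis by (rule that)
qed

text \<open>
  Let \<open>b\<close> be an element of \<open>C\<close>. It suffices to find some \<open>\<beta>\<close> congruent to \<open>b\<close> modulo \<open>N\<close> for which
  \<open>L[\<beta>]\<close> is a partial section, since then \<open>\<beta> \<in> L\<close> by maximality. If the residue of \<open>b\<close> is
  transcendental over \<open>L\<close>, then \<open>\<beta> = b\<close> works. Otherwise a minimal polynomial \<open>f\<close> with \<open>f(\<beta>) \<in> I\<close>
  is needed: division by \<open>f\<close> shows that every relation modulo \<open>N\<close> then holds modulo \<open>I\<close>. For
  separable residues one Newton step produces \<open>\<beta>\<close>. For inseparable residues the minimal polynomial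
  is \<open>X\<^sup>p - b\<^sup>p\<close>, which has coefficients in \<open>L\<close> and the exact root \<open>b\<close>.
\<close>

lemma maximal_partial_section_surjective:
  assumes L: "partial_section L" "\<And>L'. partial_section L' \<Longrightarrow> L \<subseteq> L' \<Longrightarrow> L' = L"
    and b: "b \<in> C"
  obtains l where "l \<in> L" "b - l \<in> N"
proof -
  have sub: "is_subring L" and "I \<subseteq> L" "L \<subseteq> C" and LN: "L \<inter> N \<subseteq> I" and pow: "\<forall>x\<in>C. x ^ CHAR('a) \<in> L"
    using L(1) by (auto simp: partial_section_def)
  note L_closed = subring_closed[OF sub] and result = that
  have pI: "poly h x \<in> I" if "coeffs_in I h" "x \<in> C" for h x
    using poly_coeffs_in_ideal[OF subring_C zero_I I_add I_mult] that by blast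
  have LC: "coeffs_in C h" if "coeffs_in L h" for h using that \<open>L \<subseteq> C\<close> by (auto simp: coeffs_in_def)
  show thesis
  proof (cases "\<exists>g. coeffs_in L g \<and> lead_coeff g = 1 \<and> poly g b \<in> N")
    case False
    have "poly h b \<in> I" if h: "coeffs_in L h" "poly h b \<in> N" for h
    proof (rule pI[OF _ b])
      have "Polynomial.coeff h i \<in> N" for i
        using maximal_partial_section_monic[OF L b h] False by metis
      then show "coeffs_in I h" using LN h(1) by (auto simp: coeffs_in_def)
    qed
    then have "b \<in> L" using maximal_partial_section_adjoin[OF L b] by blast
    then show thesis using that zero_N by force
  next
    case True
    define P where "P g \<longleftrightarrow> coeffs_in L g \<and> lead_coeff g = 1 \<and> poly g b \<in> N" for g
    define r where "r = (LEAST r. \<exists>g. P g \<and> Polynomial.degree g = r)"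
    obtain g where g: "P g" "Polynomial.degree g = r"
      using LeastI_ex[of "\<lambda>r. \<exists>g. P g \<and> Polynomial.degree g = r"] True by (auto simp: P_def r_def)
    have r_le: "r \<le> Polynomial.degree h" if "P h" for h
      unfolding r_def by (rule Least_le) (use that in blast)
    have small: "coeffs_in I h" if h: "coeffs_in L h" "poly h b \<in> N" "Polynomial.degree h < r" for h
    proof -
      have "Polynomial.coeff h i \<in> N" for i
      proof (rule ccontr)
        assume "Polynomial.coeff h i \<notin> N"
        then obtain g' where "coeffs_in L g'" "lead_coeff g' = 1" "poly g' b \<in> N"
          "Polynomial.degree g' \<le> Polynomial.degree h"
          using maximal_partial_section_monic[OF L b h(1,2)] by metis
        then show False using r_le[of g'] h(3) by (auto simp: P_def)
      qed
      then show ?thesis using LN h(1) by (auto simp: coeffs_in_def)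
    qed
    have "r > 0"
    proof (rule ccontr)
      assume "\<not> r > 0"
      then obtain c where "g = [:c:]" using g(2) degree_eq_zeroE[of g] by auto
      then show False using g(1) one_N by (auto simp: P_def)
    qed
    have main: thesis if \<beta>: "\<beta> \<in> C" "b - \<beta> \<in> N" and f: "P f" "Polynomial.degree f = r" "poly f \<beta> \<in> I" for \<beta> f
    proof -
      \<comment> \<open>The remainder of \<open>h\<close> on division by \<open>f\<close> has too small a degree to vanish at \<open>b\<close> modulo \<open>N\<close>,
        unless its coefficients lie in \<open>I\<close>.\<close>
      have "poly h \<beta> \<in> I" if h: "coeffs_in L h" "poly h \<beta> \<in> N" for h
      proof -
        obtain q t where qt: "coeffs_in L q" "coeffs_in L t" "h = q * f + t" "Polynomial.degree t < r"
          using coeffs_in_monic_division[OF sub _ _ _ h(1), of f] f \<open>r > 0\<close> by (auto simp: P_def)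
        have qf: "poly q \<beta> * poly f \<beta> \<in> I"
          using poly_in_subring[OF subring_C LC[OF qt(1)] \<beta>(1)] f(3) by (rule I_mult)
        have t\<beta>: "poly t \<beta> \<in> N" using N_diff[OF h(2), of "poly q \<beta> * poly f \<beta>"] qf I_N qt(3) by auto
        obtain e where e: "e \<in> C" "poly t (\<beta> + (b - \<beta>)) = poly t \<beta> + poly (pderiv t) \<beta> * (b - \<beta>) + (b - \<beta>)\<^sup>2 * e"
          using poly_taylor2[OF subring_C LC[OF qt(2)] \<beta>(1), of "b - \<beta>"] C_closed(3)[OF b \<beta>(1)] by blast
        have "poly t b \<in> N"
        proof -
          have "poly t b = poly t \<beta> + poly (pderiv t) \<beta> * (b - \<beta>) + (e * (b - \<beta>)) * (b - \<beta>)"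
            using e(2) by (simp add: power2_eq_square algebra_simps)
          also have "\<dots> \<in> N"
            using t\<beta> \<beta> e(1) b LC[OF qt(2)]
            by (intro N_add N_mult C_closed poly_in_subring[OF subring_C] coeffs_in_pderiv[OF subring_C]) auto
          finally show ?thesis .
        qed
        then have "poly t \<beta> \<in> I" using small[OF qt(2) _ qt(4)] pI \<beta>(1) by blast
        then show ?thesis using qf qt(3) I_add by auto
      qed
      then have "\<beta> \<in> L" using maximal_partial_section_adjoin[OF L \<beta>(1)] by blast
      then show thesis using \<beta>(2) result by blast
    qed
    have gL: "coeffs_in L g" and gN: "poly g b \<in> N" using g(1) by (auto simp: P_def)
    show thesis
    proof (cases "poly (pderiv g) b \<in> N")
      case False
      have "poly (pderiv g) b \<in> C"
        using LC[OF gL] b by (intro poly_in_subring[OF subring_C] coeffs_in_pderiv[OF subring_C])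
      then obtain v where v: "v \<in> C" "poly (pderiv g) b * v - 1 \<in> N"
        using N_maximal False by blast
      \<comment> \<open>The Newton step: \<open>v\<close> inverts \<open>g'(b)\<close> modulo \<open>N\<close>, so the linear terms of \<open>g(b + y)\<close> cancel
        up to a product of two elements of \<open>N\<close>.\<close>
      define y where "y = - (v * poly g b)"
      have y: "y \<in> N" unfolding y_def using v gN by (intro N_uminus N_mult)
      then have yC: "y \<in> C" using N_C by blast
      obtain e where e: "e \<in> C" "poly g (b + y) = poly g b + poly (pderiv g) b * y + y\<^sup>2 * e"
        using poly_taylor2[OF subring_C LC[OF gL] b yC] by blast
      have "poly g (b + y) = e * (y * y) - poly g b * (poly (pderiv g) b * v - 1)"
        unfolding e(2) by (simp add: y_def power2_eq_square algebra_simps)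
      also have "\<dots> \<in> I" using e(1) y gN v(2) by (intro I_diff I_mult N_square)
      finally show thesis
        using main[of "b + y" g] g y yC b C_closed(6) N_uminus by auto
    next
      case True
      \<comment> \<open>By minimality of \<open>r\<close>, the derivative vanishes modulo \<open>N\<close>. Its coefficient in degree \<open>r - 1\<close> is \<open>r\<close>,
        so the characteristic divides \<open>r\<close> and is positive.\<close>
      have "Polynomial.degree (pderiv g) < r" using g(2) \<open>r > 0\<close> by (intro le_less_trans[OF degree_le[of "r - 1"]]) (auto simp: coeff_pderiv coeff_eq_0)
      then have "coeffs_in I (pderiv g)" using small[OF coeffs_in_pderiv[OF sub gL] True] by blast
      then have "Polynomial.coeff (pderiv g) (r - 1) \<in> N" using I_N by (auto simp: coeffs_in_def)
      then have "of_nat r \<in> N" using g \<open>r > 0\<close> by (auto simp: coeff_pderiv P_def simp del: of_nat_Suc)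
      then have dvd: "CHAR('a) dvd r" by (rule of_nat_N)
      define p where "p = CHAR('a)"
      have "0 < p" "p \<le> r" using dvd \<open>r > 0\<close> by (auto simp: p_def intro: dvd_imp_le dvd_pos_nat)
      define f where "f = Polynomial.monom 1 p - [:b ^ p:]"
      have cf: "Polynomial.coeff f j = (if j = p then 1 else if j = 0 then - (b ^ p) else 0)" for j
        using \<open>0 < p\<close> by (auto simp: f_def coeff_pCons split: nat.splits)
      have df: "Polynomial.degree f = p"
        by (rule antisym[OF degree_le le_degree]) (use \<open>0 < p\<close> in \<open>auto simp: cf\<close>)
      have "b ^ p \<in> L" using pow b by (auto simp: p_def)
      then have "coeffs_in L f" by (auto simp: coeffs_in_def cf intro!: L_closed)
      moreover have f0: "poly f b = 0" by (simp add: f_def poly_monom)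
      ultimately have "P f" using zero_N by (auto simp: P_def df cf)
      then have "p = r" using r_le[of f] df \<open>p \<le> r\<close> by simp
      then show thesis using main[OF b _ \<open>P f\<close>] df f0 zero_I zero_N by simp
    qed
  qed
qed

proposition ex_section:
  obtains L where "is_subring L" "I \<subseteq> L" "L \<subseteq> C" "L \<inter> N \<subseteq> I"
    "\<And>b. b \<in> C \<Longrightarrow> \<exists>l\<in>L. b - l \<in> N"
proof -
  obtain L where L: "partial_section L" "\<And>L'. partial_section L' \<Longrightarrow> L \<subseteq> L' \<Longrightarrow> L' = L"
    using ex_maximal_partial_section by blast
  show thesis
  proof (rule that)
    show "is_subring L" "I \<subseteq> L" "L \<subseteq> C" "L \<inter> N \<subseteq> I" using L(1) by (simp_all add: partial_section_def)
    show "\<exists>l\<in>L. b - l \<in> N" if "b \<in> C" for b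
      using maximal_partial_section_surjective[OF L that] by metis
  qed
qed

end

section \<open>Coefficient fields modulo higher powers\<close>

text \<open>
  The case in point is the filtration of a local ring \<open>M\<^sub>0\<close> of equal characteristic by the powers
  of its maximal ideal \<open>M\<^sub>1\<close>.
\<close>

locale ideal_filtration =
  fixes M :: "nat \<Rightarrow> 'a::idom set"
  assumes subring_M0: "is_subring (M 0)"
    and M_zero: "0 \<in> M i"
    and M_diff: "x \<in> M i \<Longrightarrow> y \<in> M i \<Longrightarrow> x - y \<in> M i"
    and M_mult: "x \<in> M i \<Longrightarrow> y \<in> M j \<Longrightarrow> x * y \<in> M (i + j)"
    and M_Suc: "M (Suc i) \<subseteq> M i"
    and one_M1: "1 \<notin> M 1"
    and M0_unit: "x \<in> M 0 \<Longrightarrow> x \<notin> M 1 \<Longrightarrow> \<exists>y\<in>M 0. x * y = 1"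
    and of_nat_M1: "of_nat r \<in> M 1 \<Longrightarrow> CHAR('a) dvd r"
begin

lemmas M0_closed = subring_closed[OF subring_M0]

lemma M_antimono: "i \<le> j \<Longrightarrow> M j \<subseteq> M i"
  using M_Suc by (rule lift_Suc_antimono_le)

lemma M_uminus: "x \<in> M i \<Longrightarrow> - x \<in> M i" using M_diff[OF M_zero] by fastforce
lemma M_add: "x \<in> M i \<Longrightarrow> y \<in> M i \<Longrightarrow> x + y \<in> M i" using M_diff[of x i "- y"] M_uminus[of y] by simp
lemma M_mult0: "x \<in> M 0 \<Longrightarrow> y \<in> M i \<Longrightarrow> x * y \<in> M i" using M_mult[of x 0 y i] by simp

text \<open>
  Modulo \<open>M\<^sub>n\<close> the subring \<open>L\<close> is a coefficient field of \<open>M\<^sub>0 / M\<^sub>n\<close>. The preimage \<open>C\<close> of a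
  coefficient field modulo \<open>M\<^sub>n\<close> has the ideal \<open>M\<^sub>n\<close>, whose square lies in \<open>M\<^sub>n\<^sub>+\<^sub>1\<close>; a section of this
  square-zero thickening is a coefficient field modulo \<open>M\<^sub>n\<^sub>+\<^sub>1\<close>.
\<close>

proposition ex_coefficient_ring:
  assumes "n \<ge> 1"
  shows "\<exists>L. is_subring L \<and> M n \<subseteq> L \<and> L \<subseteq> M 0 \<and> L \<inter> M 1 \<subseteq> M n \<and> (\<forall>x\<in>M 0. \<exists>l\<in>L. x - l \<in> M 1)"
  using assms
proof (induction n rule: dec_induct)
  case base
  then show ?case
    using subring_M0 M_antimono[of 0 1] M_zero by (intro exI[of _ "M 0"]) (auto intro!: bexI[of _ x for x])
next
  case (step n)
  then obtain C where C: "is_subring C" "M n \<subseteq> C" "C \<subseteq> M 0" "C \<inter> M 1 \<subseteq> M n"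
    and surj: "\<And>x. x \<in> M 0 \<Longrightarrow> \<exists>l\<in>C. x - l \<in> M 1" by blast
  have n1: "M n \<subseteq> M 1" using M_antimono[OF step.hyps(1)] by simp
  have max: "\<exists>y\<in>C. x * y - 1 \<in> M n" if x: "x \<in> C" "x \<notin> M n" for x
  proof -
    have "x \<in> M 0" "x \<notin> M 1" using x C(3,4) by auto
    then obtain y where y: "y \<in> M 0" "x * y = 1" using M0_unit by blast
    obtain l where l: "l \<in> C" "y - l \<in> M 1" using surj y by blast
    have "x * (y - l) \<in> M 1" using M_mult0 \<open>x \<in> M 0\<close> l by blast
    then have "x * l - 1 \<in> M 1" using y M_uminus by (fastforce simp: algebra_simps)
    moreover have "x * l - 1 \<in> C" using x l subring_closed[OF C(1)] by auto
    ultimately show ?thesis using l C(4) by blast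
  qed
  interpret square_zero_thickening C "M n" "M (Suc n)"
  proof unfold_locales
    show "x * y \<in> M (Suc n)" if "x \<in> M n" "y \<in> M n" for x y
      using M_mult[OF that] M_antimono[of "Suc n" "n + n"] step.hyps by auto
    show "c * x \<in> M n" if "c \<in> C" "x \<in> M n" for c x using M_mult0 that C(3) by blast
    show "c * x \<in> M (Suc n)" if "c \<in> C" "x \<in> M (Suc n)" for c x using M_mult0 that C(3) by blast
    show "1 \<notin> M n" using n1 one_M1 by blast
    show "of_nat r \<in> M n \<Longrightarrow> CHAR('a) dvd r" for r using n1 of_nat_M1 by blast
  qed (use C max M_Suc M_zero M_diff in auto)
  obtain L where L: "is_subring L" "M (Suc n) \<subseteq> L" "L \<subseteq> C" "L \<inter> M n \<subseteq> M (Suc n)"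
    "\<And>b. b \<in> C \<Longrightarrow> \<exists>l\<in>L. b - l \<in> M n" using ex_section by blast
  have "\<exists>l\<in>L. x - l \<in> M 1" if x: "x \<in> M 0" for x
  proof -
    obtain c where c: "c \<in> C" "x - c \<in> M 1" using surj[OF x] by blast
    obtain l where l: "l \<in> L" "c - l \<in> M n" using L(5) c by blast
    then have "(x - c) + (c - l) \<in> M 1" using c n1 by (intro M_add) auto
    then show ?thesis using l by auto
  qed
  then show ?case using L C by blast
qed

end

section \<open>Linear functionals on a quotient\<close>

text \<open>
  The quotient \<open>V / M\<close> is a vector space over \<open>'k\<close>, on which \<open>c\<close> acts as multiplication by \<open>s c\<close>. The
  map \<open>s\<close> is a ring homomorphism only modulo \<open>M\<close>, so that functionals and subspaces are
  described on \<open>V\<close>.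
\<close>

locale coefficient_space =
  fixes V M :: "'b::comm_ring_1 set" and s :: "'k::field \<Rightarrow> 'b"
  assumes subring_V: "is_subring V" and M_V: "M \<subseteq> V" and M_zero: "0 \<in> M"
    and M_diff: "x \<in> M \<Longrightarrow> y \<in> M \<Longrightarrow> x - y \<in> M"
    and M_mult: "v \<in> V \<Longrightarrow> x \<in> M \<Longrightarrow> v * x \<in> M"
    and s_V: "s c \<in> V"
    and s_add: "s (a + b) - s a - s b \<in> M"
    and s_mult: "s (a * b) - s a * s b \<in> M"
    and s_one: "s 1 - 1 \<in> M"
begin

lemmas V_closed = subring_closed[OF subring_V]

lemma M_uminus: "x \<in> M \<Longrightarrow> - x \<in> M" using M_diff[OF M_zero] by fastforce
lemma M_add: "x \<in> M \<Longrightarrow> y \<in> M \<Longrightarrow> x + y \<in> M" using M_diff[of x "- y"] M_uminus[of y] by simp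
lemma M_mult': "x \<in> M \<Longrightarrow> v \<in> V \<Longrightarrow> x * v \<in> M" using M_mult[of v x] by (simp add: mult.commute)

lemma s_zero: "s 0 \<in> M" using M_uminus[OF s_add[of 0 0]] by simp

lemma s_diff: "s a - s b - s (a - b) \<in> M"
  using s_add[of "a - b" b] by (simp add: algebra_simps)

definition functional :: "('b \<Rightarrow> 'k) \<Rightarrow> bool" where
  "functional \<mu> \<longleftrightarrow> (\<forall>v\<in>V. \<forall>w\<in>V. \<mu> (v + w) = \<mu> v + \<mu> w) \<and>
    (\<forall>c. \<forall>v\<in>V. \<mu> (s c * v) = c * \<mu> v) \<and> (\<forall>v\<in>M. \<mu> v = 0)"

lemma functional_cong:
  assumes "functional \<mu>" "v \<in> V" "w \<in> V" "v - w \<in> M"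
  shows "\<mu> v = \<mu> w"
proof -
  have "\<mu> (w + (v - w)) = \<mu> w + \<mu> (v - w)" using assms M_V unfolding functional_def by blast
  then show ?thesis using assms by (simp add: functional_def)
qed

definition subspace :: "'b set \<Rightarrow> bool" where
  "subspace H \<longleftrightarrow> M \<subseteq> H \<and> H \<subseteq> V \<and> (\<forall>v\<in>H. \<forall>w\<in>H. v - w \<in> H) \<and> (\<forall>c. \<forall>v\<in>H. s c * v \<in> H)"

lemma subspace_add:
  assumes "subspace H" "v \<in> H" "w \<in> H"
  shows "v + w \<in> H"
proof -
  have "0 \<in> H" using assms M_zero by (auto simp: subspace_def)
  then have "0 - w \<in> H" using assms unfolding subspace_def by blast
  then have "v - (0 - w) \<in> H" using assms unfolding subspace_def by blast
  then show ?thesis by simp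
qed

text \<open>
  A subspace maximal among those that avoid \<open>f\<close> is a complement of the line spanned by \<open>f\<close>: adding
  any further vector \<open>v\<close> makes \<open>f\<close> a combination \<open>h + c v\<close> with \<open>c \<noteq> 0\<close>, which can be solved for
  \<open>v\<close>.
\<close>

lemma ex_hyperplane_avoiding:
  assumes "f \<in> V" "f \<notin> M"
  obtains H where "subspace H" "f \<notin> H" "\<And>v. v \<in> V \<Longrightarrow> \<exists>c. v - s c * f \<in> H"
proof -
  define A where "A = {H. subspace H \<and> f \<notin> H}"
  have "\<exists>H\<in>A. \<forall>Z\<in>A. H \<subseteq> Z \<longrightarrow> Z = H"
  proof (rule subset_Zorn_nonempty)
    have "subspace M" using M_V M_diff M_mult s_V by (auto simp: subspace_def)
    then show "A \<noteq> {}" using assms by (auto simp: A_def)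
    fix \<C> assume ne: "\<C> \<noteq> {}" and ch: "subset.chain A \<C>"
    have sub: "subspace Z" "f \<notin> Z" if "Z \<in> \<C>" for Z
      using ch that by (auto simp: subset_chain_def A_def)
    have "v - w \<in> \<Union>\<C>" if vw: "v \<in> \<Union>\<C>" "w \<in> \<Union>\<C>" for v w
    proof -
      obtain Z where "Z \<in> \<C>" "v \<in> Z" "w \<in> Z" using Union_chain_pair[OF ch vw] .
      then show ?thesis using sub(1) unfolding subspace_def by blast
    qed
    moreover have "M \<subseteq> \<Union>\<C>" using ne sub(1) unfolding subspace_def by blast
    moreover have "\<Union>\<C> \<subseteq> V" "\<forall>c. \<forall>v\<in>\<Union>\<C>. s c * v \<in> \<Union>\<C>" using sub(1) unfolding subspace_def by blast+
    ultimately show "\<Union>\<C> \<in> A" using sub(2) unfolding A_def subspace_def by blast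
  qed
  then obtain H where H: "subspace H" "f \<notin> H" and Hmax: "\<And>Z. subspace Z \<Longrightarrow> f \<notin> Z \<Longrightarrow> H \<subseteq> Z \<Longrightarrow> Z = H"
    unfolding A_def by blast
  have MH: "M \<subseteq> H" and HV: "H \<subseteq> V" and H_diff: "\<And>v w. v \<in> H \<Longrightarrow> w \<in> H \<Longrightarrow> v - w \<in> H"
    and H_scale: "\<And>c v. v \<in> H \<Longrightarrow> s c * v \<in> H" using H(1) by (auto simp: subspace_def)
  note H_add = subspace_add[OF H(1)]
  have "\<exists>c. v - s c * f \<in> H" if v: "v \<in> V" for v
  proof (cases "v \<in> H")
    case True
    have "s 0 * f \<in> H" using M_mult'[OF s_zero assms(1)] MH by blast
    then show ?thesis using H_diff[OF True] by blast
  next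
    case False
    define H' where "H' = {h + s c * v | h c. h \<in> H}"
    have mem: "h + s c * v \<in> H'" if "h \<in> H" for h c using that by (auto simp: H'_def)
    have HH': "H \<subseteq> H'"
    proof
      fix h assume "h \<in> H"
      then have "(h - s 0 * v) + s 0 * v \<in> H'" using M_mult'[OF s_zero v] MH by (intro mem H_diff) auto
      then show "h \<in> H'" by simp
    qed
    have "s 1 * v - v \<in> M" using M_mult'[OF s_one v] by (simp add: algebra_simps)
    then have "- (s 1 * v - v) + s 1 * v \<in> H'" using M_uminus MH by (intro mem) blast
    then have "v \<in> H'" by simp
    have "subspace H'"
      unfolding subspace_def
    proof (intro conjI ballI allI)
      show "M \<subseteq> H'" using MH HH' by blast
      show "H' \<subseteq> V" using HV v s_V by (auto simp: H'_def intro!: V_closed)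
      fix x assume "x \<in> H'"
      then obtain h c where x: "x = h + s c * v" "h \<in> H" by (auto simp: H'_def)
      show "s a * x \<in> H'" for a
      proof -
        have "(s a * h - (s (a * c) - s a * s c) * v) + s (a * c) * v \<in> H'"
          by (rule mem[OF H_diff[OF H_scale[OF x(2)] subsetD[OF MH M_mult'[OF s_mult v]]]])
        then show ?thesis by (simp add: x algebra_simps)
      qed
      fix y assume "y \<in> H'"
      then obtain k d where y: "y = k + s d * v" "k \<in> H" by (auto simp: H'_def)
      have "((h - k) + (s c - s d - s (c - d)) * v) + s (c - d) * v \<in> H'"
        by (rule mem[OF H_add[OF H_diff[OF x(2) y(2)] subsetD[OF MH M_mult'[OF s_diff v]]]])
      then show "x - y \<in> H'" by (simp add: x y algebra_simps)
    qed
    then have "f \<in> H'" using Hmax[of H'] HH' \<open>v \<in> H'\<close> False by blast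
    then obtain h c where f: "f = h + s c * v" "h \<in> H" by (auto simp: H'_def)
    have "c \<noteq> 0"
    proof
      assume "c = 0"
      then have "f \<in> H" using f H_add M_mult'[OF s_zero v] MH by blast
      then show False using H(2) by blast
    qed
    let ?a = "inverse c"
    have "s (?a * c) - s ?a * s c - (s 1 - 1) \<in> M" by (rule M_diff[OF s_mult s_one])
    then have "1 - s ?a * s c \<in> M" using \<open>c \<noteq> 0\<close> by simp
    then have "(1 - s ?a * s c) * v - s ?a * h \<in> H"
      using f M_mult' v MH by (intro H_diff H_scale) auto
    then have "v - s ?a * f \<in> H" by (simp add: f algebra_simps)
    then show ?thesis by blast
  qed
  then show thesis using that H by blast
qed

lemma ex_functional_eq_1:
  assumes f: "f \<in> V" "f \<notin> M"
  obtains \<mu> where "functional \<mu>" "\<mu> f = 1"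
proof -
  obtain H where H: "subspace H" "f \<notin> H" and ex: "\<And>v. v \<in> V \<Longrightarrow> \<exists>c. v - s c * f \<in> H"
    using ex_hyperplane_avoiding[OF f] by blast
  have MH: "M \<subseteq> H" and HV: "H \<subseteq> V" and H_diff: "\<And>v w. v \<in> H \<Longrightarrow> w \<in> H \<Longrightarrow> v - w \<in> H"
    and H_scale: "\<And>c v. v \<in> H \<Longrightarrow> s c * v \<in> H" using H(1) by (auto simp: subspace_def)
  note H_add = subspace_add[OF H(1)]
  have s1f: "s 1 * f - f \<in> H" using M_mult'[OF s_one f(1)] MH by (auto simp: algebra_simps)
  have unique: "c = d" if "v - s c * f \<in> H" "v - s d * f \<in> H" for v c d
  proof (rule ccontr)
    assume "c \<noteq> d"
    let ?a = "inverse (c - d)"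
    have "(s c - s d - s (c - d)) * f \<in> H" using M_mult'[OF s_diff f(1)] MH by blast
    then have "(v - s d * f) - (v - s c * f) - (s c - s d - s (c - d)) * f \<in> H"
      by (intro H_diff[OF H_diff[OF that(2,1)]])
    then have "s (c - d) * f \<in> H" by (simp add: algebra_simps)
    moreover have "(s (?a * (c - d)) - s ?a * s (c - d)) * f \<in> H" using M_mult'[OF s_mult f(1)] MH by blast
    ultimately have "s ?a * (s (c - d) * f) + (s (?a * (c - d)) - s ?a * s (c - d)) * f - (s 1 * f - f) \<in> H"
      by (intro H_diff[OF H_add[OF H_scale] s1f])
    moreover have "?a * (c - d) = 1" using \<open>c \<noteq> d\<close> by simp
    ultimately have "f \<in> H" by (simp only: \<open>?a * (c - d) = 1\<close>) (simp add: algebra_simps)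
    then show False using H(2) by blast
  qed
  define \<mu> where "\<mu> v = (THE c. v - s c * f \<in> H)" for v
  have \<mu>_eq: "\<mu> v = c" if "v - s c * f \<in> H" for v c
    unfolding \<mu>_def by (rule the_equality) (use that unique in blast)+
  have \<mu>_mem: "v - s (\<mu> v) * f \<in> H" if "v \<in> V" for v
    using ex[OF that] \<mu>_eq by auto
  have "functional \<mu>"
    unfolding functional_def
  proof (intro conjI ballI allI)
    fix v w assume vw: "v \<in> V" "w \<in> V"
    show "\<mu> (v + w) = \<mu> v + \<mu> w"
    proof (rule \<mu>_eq)
      have "(v - s (\<mu> v) * f) + (w - s (\<mu> w) * f) - (s (\<mu> v + \<mu> w) - s (\<mu> v) - s (\<mu> w)) * f \<in> H"
        by (rule H_diff[OF H_add[OF \<mu>_mem[OF vw(1)] \<mu>_mem[OF vw(2)]]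
              subsetD[OF MH M_mult'[OF s_add f(1)]]])
      then show "v + w - s (\<mu> v + \<mu> w) * f \<in> H" by (simp add: algebra_simps)
    qed
  next
    fix c v assume v: "v \<in> V"
    show "\<mu> (s c * v) = c * \<mu> v"
    proof (rule \<mu>_eq)
      have "s c * (v - s (\<mu> v) * f) - (s (c * \<mu> v) - s c * s (\<mu> v)) * f \<in> H"
        by (rule H_diff[OF H_scale[OF \<mu>_mem[OF v]] subsetD[OF MH M_mult'[OF s_mult f(1)]]])
      then show "s c * v - s (c * \<mu> v) * f \<in> H" by (simp add: algebra_simps)
    qed
  next
    fix v assume "v \<in> M"
    then show "\<mu> v = 0" using M_mult'[OF s_zero f(1)] M_diff MH by (blast intro: \<mu>_eq)
  qed
  moreover have "f - s 1 * f \<in> H" using H_diff[OF _ s1f, of 0] MH M_zero by auto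
  then have "\<mu> f = 1" by (rule \<mu>_eq)
  ultimately show thesis by (rule that)
qed

definition combine :: "(('b \<Rightarrow> 'k) \<times> 'b) list \<Rightarrow> 'b \<Rightarrow> 'b" where
  "combine ws v = (\<Sum>(\<mu>, w)\<leftarrow>ws. s (\<mu> v) * w)"

lemma combine_linear:
  assumes "\<forall>(\<mu>, w)\<in>set ws. functional \<mu> \<and> w \<in> V"
  shows "v \<in> V \<Longrightarrow> combine ws v \<in> V"
    and "v \<in> V \<Longrightarrow> w \<in> V \<Longrightarrow> combine ws (v + w) - combine ws v - combine ws w \<in> M"
    and "v \<in> V \<Longrightarrow> combine ws (s c * v) - s c * combine ws v \<in> M"
    and "v \<in> M \<Longrightarrow> combine ws v \<in> M"
proof -
  show "v \<in> V \<Longrightarrow> combine ws v \<in> V"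
    using assms by (induction ws) (auto simp: combine_def intro!: V_closed s_V)
  show "v \<in> V \<Longrightarrow> w \<in> V \<Longrightarrow> combine ws (v + w) - combine ws v - combine ws w \<in> M"
    using assms
  proof (induction ws)
    case (Cons p ws)
    obtain \<mu> u where p: "p = (\<mu>, u)" by fastforce
    then have \<mu>: "\<mu> (v + w) = \<mu> v + \<mu> w" "u \<in> V" using Cons.prems by (auto simp: functional_def)
    have "(s (\<mu> v + \<mu> w) - s (\<mu> v) - s (\<mu> w)) * u
        + (combine ws (v + w) - combine ws v - combine ws w) \<in> M"
      using Cons M_mult'[OF s_add \<mu>(2)] by (intro M_add) auto
    then show ?case by (simp add: combine_def p \<mu> algebra_simps)
  qed (simp add: combine_def M_zero)
  show "v \<in> V \<Longrightarrow> combine ws (s c * v) - s c * combine ws v \<in> M"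
    using assms
  proof (induction ws)
    case (Cons p ws)
    obtain \<mu> u where p: "p = (\<mu>, u)" by fastforce
    then have \<mu>: "\<mu> (s c * v) = c * \<mu> v" "u \<in> V" using Cons.prems by (auto simp: functional_def)
    have "(s (c * \<mu> v) - s c * s (\<mu> v)) * u + (combine ws (s c * v) - s c * combine ws v) \<in> M"
      using Cons M_mult'[OF s_mult \<mu>(2)] by (intro M_add) auto
    moreover have "combine (p # ws) x = s (\<mu> x) * u + combine ws x" for x
      by (simp add: combine_def p)
    ultimately show ?case by (simp only: \<mu>(1)) (simp add: algebra_simps)
  qed (simp add: combine_def M_zero)
  show "v \<in> M \<Longrightarrow> combine ws v \<in> M"
    using assms
    by (induction ws) (auto simp: combine_def M_zero functional_def intro!: M_add M_mult' s_zero)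
qed

text \<open>
  Every finite set of vectors is reproduced by finitely many functionals. To treat one more vector
  \<open>b\<close>, let \<open>\<pi> v\<close> be the part of \<open>v\<close> that the given functionals miss, take a functional with value \<open>1\<close>
  at \<open>\<pi> b\<close>, and compose it with \<open>\<pi>\<close>; the vectors handled before are unaffected, as \<open>\<pi>\<close> kills
  them.
\<close>

proposition ex_dual_family:
  assumes "finite B" "B \<subseteq> V"
  shows "\<exists>ws. (\<forall>(\<mu>, w)\<in>set ws. functional \<mu> \<and> w \<in> V) \<and> (\<forall>v\<in>B. v - combine ws v \<in> M)"
  using assms
proof (induction B rule: finite_induct)
  case empty
  then show ?case by (intro exI[of _ "[]"]) auto
next
  case (insert b B)
  then obtain ws where ws: "\<forall>(\<mu>, w)\<in>set ws. functional \<mu> \<and> w \<in> V" "\<forall>v\<in>B. v - combine ws v \<in> M"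
    by auto
  note lin = combine_linear[OF ws(1)]
  define \<pi> where "\<pi> v = v - combine ws v" for v
  have \<pi>_V: "\<pi> v \<in> V" if "v \<in> V" for v using lin(1)[OF that] that V_closed(3) by (simp add: \<pi>_def)
  have bV: "b \<in> V" using insert.prems by blast
  show ?case
  proof (cases "\<pi> b \<in> M")
    case True
    then show ?thesis using ws by (auto simp: \<pi>_def)
  next
    case False
    then obtain \<mu> where \<mu>: "functional \<mu>" "\<mu> (\<pi> b) = 1" using ex_functional_eq_1 \<pi>_V[OF bV] by blast
    have \<nu>: "functional (\<lambda>v. \<mu> (\<pi> v))"
      unfolding functional_def
    proof (intro conjI ballI allI)
      fix v w assume vw: "v \<in> V" "w \<in> V"
      have "\<pi> (v + w) - (\<pi> v + \<pi> w) = - (combine ws (v + w) - combine ws v - combine ws w)"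
        by (simp add: \<pi>_def)
      also have "\<dots> \<in> M" by (intro M_uminus lin vw)
      finally have "\<mu> (\<pi> (v + w)) = \<mu> (\<pi> v + \<pi> w)"
        using \<pi>_V vw V_closed(6) by (intro functional_cong[OF \<mu>(1)]) auto
      then show "\<mu> (\<pi> (v + w)) = \<mu> (\<pi> v) + \<mu> (\<pi> w)" using \<mu>(1) \<pi>_V vw by (simp add: functional_def)
    next
      fix c v assume v: "v \<in> V"
      have "\<pi> (s c * v) - s c * \<pi> v = - (combine ws (s c * v) - s c * combine ws v)"
        by (simp add: \<pi>_def algebra_simps)
      also have "\<dots> \<in> M" by (intro M_uminus lin v)
      finally have "\<mu> (\<pi> (s c * v)) = \<mu> (s c * \<pi> v)"
        using \<pi>_V v V_closed(4)[OF s_V] by (intro functional_cong[OF \<mu>(1)]) auto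
      then show "\<mu> (\<pi> (s c * v)) = c * \<mu> (\<pi> v)" using \<mu>(1) \<pi>_V v by (simp add: functional_def)
    next
      fix v assume "v \<in> M"
      then have "\<pi> v \<in> M" unfolding \<pi>_def by (intro M_diff lin)
      then show "\<mu> (\<pi> v) = 0" using \<mu>(1) by (simp add: functional_def)
    qed
    let ?ws = "(\<lambda>v. \<mu> (\<pi> v), \<pi> b) # ws"
    have eq: "v - combine ?ws v = \<pi> v - s (\<mu> (\<pi> v)) * \<pi> b" for v
      by (simp add: combine_def \<pi>_def algebra_simps)
    have "v - combine ?ws v \<in> M" if "v \<in> insert b B" for v
      unfolding eq
    proof (cases "v = b")
      case True
      have "- ((s 1 - 1) * \<pi> b) \<in> M" using M_mult'[OF s_one \<pi>_V[OF bV]] by (rule M_uminus)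
      then show "\<pi> v - s (\<mu> (\<pi> v)) * \<pi> b \<in> M" by (simp add: True \<mu>(2) algebra_simps)
    next
      case False
      then have v: "\<pi> v \<in> M" using that ws(2) by (auto simp: \<pi>_def)
      then have "\<mu> (\<pi> v) = 0" using \<mu>(1) by (simp add: functional_def)
      then show "\<pi> v - s (\<mu> (\<pi> v)) * \<pi> b \<in> M"
        using v M_mult'[OF s_zero \<pi>_V[OF bV]] M_diff by auto
    qed
    then show ?thesis using ws(1) \<nu> \<pi>_V[OF bV] by (intro exI[of _ ?ws]) auto
  qed
qed

end

section \<open>Polynomials in several variables\<close>

type_synonym 'a mpoly = "(nat \<Rightarrow>\<^sub>0 nat) \<Rightarrow>\<^sub>0 'a"

abbreviation mconst :: "'a::comm_ring_1 \<Rightarrow> 'a mpoly" where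
  "mconst c \<equiv> Poly_Mapping.single 0 c"

abbreviation mvar :: "nat \<Rightarrow> 'a::comm_ring_1 mpoly" where
  "mvar i \<equiv> Poly_Mapping.single (Poly_Mapping.single i 1) 1"

text \<open>
  Coefficients are restricted to a set that is usually an ideal \<open>M\<^sub>j\<close>, so \<open>mpolys_over d (M j)\<close> stands
  for \<open>M\<^sub>j[X\<^sub>1, \<dots>, X\<^sub>d]\<close>.
\<close>

definition mpolys_over :: "nat \<Rightarrow> 'a::zero set \<Rightarrow> 'a mpoly set" where
  "mpolys_over d A = {p. (\<forall>m. Poly_Mapping.lookup p m \<in> A) \<and>
     (\<forall>m\<in>Poly_Mapping.keys p. Poly_Mapping.keys m \<subseteq> {..<d})}"

lemma carrier_mpoly_ring: "carrier (mpoly_ring d) = mpolys_over d UNIV"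
  by (simp add: mpoly_ring_def mpolys_over_def)

lemma sum_single_superset:
  assumes "finite A" "Poly_Mapping.keys p \<subseteq> A"
  shows "p = (\<Sum>a\<in>A. Poly_Mapping.single a (Poly_Mapping.lookup p a))"
proof (rule poly_mapping_eqI)
  fix m
  have "Poly_Mapping.lookup (\<Sum>a\<in>A. Poly_Mapping.single a (Poly_Mapping.lookup p a)) m
      = (\<Sum>a\<in>A. if a = m then Poly_Mapping.lookup p a else 0)"
    by (simp add: lookup_sum lookup_single when_def)
  also have "\<dots> = Poly_Mapping.lookup p m"
    using assms by (auto simp: in_keys_iff)
  finally show "Poly_Mapping.lookup p m = Poly_Mapping.lookup (\<Sum>a\<in>A. Poly_Mapping.single a (Poly_Mapping.lookup p a)) m"
    by simp
qed

text \<open>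
  The index sets may exceed the supports. This matters when a map applied to the coefficients
  annihilates some of them.
\<close>

lemma mult_sum_single:
  fixes p q :: "'b::comm_monoid_add \<Rightarrow>\<^sub>0 'a::comm_semiring_0"
  assumes "finite A" "Poly_Mapping.keys p \<subseteq> A" "finite B" "Poly_Mapping.keys q \<subseteq> B"
  shows "p * q = (\<Sum>a\<in>A. \<Sum>b\<in>B.
    Poly_Mapping.single (a + b) (Poly_Mapping.lookup p a * Poly_Mapping.lookup q b))"
  by (subst sum_single_superset[OF assms(1,2)], subst sum_single_superset[OF assms(3,4)])
    (simp add: sum_product mult_single)

lemma
  fixes A :: "'a::comm_ring_1 set"
  assumes zero: "0 \<in> A" and diff: "\<And>x y. x \<in> A \<Longrightarrow> y \<in> A \<Longrightarrow> x - y \<in> A"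
  shows mpolys_over_zero: "0 \<in> mpolys_over d A"
    and mpolys_over_add: "p \<in> mpolys_over d A \<Longrightarrow> q \<in> mpolys_over d A \<Longrightarrow> p + q \<in> mpolys_over d A"
    and mpolys_over_diff: "p \<in> mpolys_over d A \<Longrightarrow> q \<in> mpolys_over d A \<Longrightarrow> p - q \<in> mpolys_over d A"
    and mpolys_over_sum: "(\<And>i. i \<in> I \<Longrightarrow> f i \<in> mpolys_over d A) \<Longrightarrow> sum f I \<in> mpolys_over d A"
    and mpolys_over_single: "c \<in> A \<Longrightarrow> Poly_Mapping.keys m \<subseteq> {..<d} \<Longrightarrow> Poly_Mapping.single m c \<in> mpolys_over d A"
proof -
  have add: "x + y \<in> A" if "x \<in> A" "y \<in> A" for x y
    using diff[OF that(1) diff[OF zero that(2)]] by simp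
  show z: "0 \<in> mpolys_over d A" using zero by (simp add: mpolys_over_def)
  show "p - q \<in> mpolys_over d A" if "p \<in> mpolys_over d A" "q \<in> mpolys_over d A" for p q
    unfolding mpolys_over_def
  proof (intro CollectI conjI allI ballI)
    show "Poly_Mapping.lookup (p - q) m \<in> A" for m
      using that diff by (simp add: mpolys_over_def lookup_minus)
    show "Poly_Mapping.keys m \<subseteq> {..<d}" if "m \<in> Poly_Mapping.keys (p - q)" for m
      using subsetD[OF keys_diff that] \<open>p \<in> _\<close> \<open>q \<in> _\<close> unfolding mpolys_over_def by blast
  qed
  show add': "p + q \<in> mpolys_over d A" if "p \<in> mpolys_over d A" "q \<in> mpolys_over d A" for p q
    unfolding mpolys_over_def
  proof (intro CollectI conjI allI ballI)
    show "Poly_Mapping.lookup (p + q) m \<in> A" for m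
      using that add by (simp add: mpolys_over_def lookup_add)
    show "Poly_Mapping.keys m \<subseteq> {..<d}" if "m \<in> Poly_Mapping.keys (p + q)" for m
      using subsetD[OF Poly_Mapping.keys_add that] \<open>p \<in> _\<close> \<open>q \<in> _\<close> unfolding mpolys_over_def by blast
  qed
  show "(\<And>i. i \<in> I \<Longrightarrow> f i \<in> mpolys_over d A) \<Longrightarrow> sum f I \<in> mpolys_over d A"
    by (induction I rule: infinite_finite_induct) (auto intro: z add')
  show "c \<in> A \<Longrightarrow> Poly_Mapping.keys m \<subseteq> {..<d} \<Longrightarrow> Poly_Mapping.single m c \<in> mpolys_over d A"
    using zero by (auto simp: mpolys_over_def lookup_single when_def split: if_splits)
qed

lemma mpolys_over_mult:
  fixes C :: "'a::comm_ring_1 set"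
  assumes "0 \<in> C" "\<And>x y. x \<in> C \<Longrightarrow> y \<in> C \<Longrightarrow> x - y \<in> C"
    and "\<And>x y. x \<in> A \<Longrightarrow> y \<in> B \<Longrightarrow> x * y \<in> C"
    and p: "p \<in> mpolys_over d A" and q: "q \<in> mpolys_over d B"
  shows "p * q \<in> mpolys_over d C"
proof -
  have "Poly_Mapping.keys (a + b) \<subseteq> {..<d}"
    if "a \<in> Poly_Mapping.keys p" "b \<in> Poly_Mapping.keys q" for a b
  proof -
    have "Poly_Mapping.keys a \<subseteq> {..<d}" "Poly_Mapping.keys b \<subseteq> {..<d}"
      using that p q by (simp_all add: mpolys_over_def)
    then show ?thesis using Poly_Mapping.keys_add[of a b] by blast
  qed
  moreover have "Poly_Mapping.lookup p a * Poly_Mapping.lookup q b \<in> C" for a b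
    using p q assms(3) by (simp add: mpolys_over_def)
  ultimately show ?thesis
    unfolding mult_sum_single[OF finite_keys order.refl finite_keys order.refl, of p q]
    by (intro mpolys_over_sum[OF assms(1,2)] mpolys_over_single[OF assms(1,2)])
qed

lemma single_sum_eq_prod:
  "Poly_Mapping.single (sum f I) (1::'a::comm_ring_1) = (\<Prod>i\<in>I. Poly_Mapping.single (f i) 1)"
proof (induction I rule: infinite_finite_induct)
  case (insert i I)
  then show ?case using mult_single[of "f i" "1::'a" "sum f I" 1] by simp
qed simp_all

lemma single_var_power:
  "Poly_Mapping.single (Poly_Mapping.single i k) (1::'a::comm_ring_1) = mvar i ^ k"
proof (induction k)
  case (Suc k)
  have "Poly_Mapping.single i (Suc k) = Poly_Mapping.single i 1 + Poly_Mapping.single i k"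
    by (simp flip: single_add)
  then show ?case
    using Suc mult_single[of "Poly_Mapping.single i 1" "1::'a" "Poly_Mapping.single i k" 1] by simp
qed simp

lemma mpoly_induct [consumes 1, case_names const var add mult]:
  fixes p :: "'a::comm_ring_1 mpoly"
  assumes p: "p \<in> mpolys_over d UNIV"
    and const: "\<And>c. P (mconst c)" and var: "\<And>i. i < d \<Longrightarrow> P (mvar i)"
    and add: "\<And>p q. p \<in> mpolys_over d UNIV \<Longrightarrow> q \<in> mpolys_over d UNIV \<Longrightarrow> P p \<Longrightarrow> P q \<Longrightarrow> P (p + q)"
    and mult: "\<And>p q. p \<in> mpolys_over d UNIV \<Longrightarrow> q \<in> mpolys_over d UNIV \<Longrightarrow> P p \<Longrightarrow> P q \<Longrightarrow> P (p * q)"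
  shows "P p"
proof -
  define C where "C = {p. p \<in> mpolys_over d UNIV \<and> P p}"
  have C_const: "mconst c \<in> C" for c
    using const by (auto simp: C_def intro!: mpolys_over_single)
  have C_var: "mvar i \<in> C" if "i < d" for i
    using var that by (auto simp: C_def intro!: mpolys_over_single)
  have C_add: "p + q \<in> C" and C_mult: "p * q \<in> C" if "p \<in> C" "q \<in> C" for p q
    using that add mult by (auto simp: C_def intro!: mpolys_over_add mpolys_over_mult[of _ UNIV UNIV])
  have C_one: "1 \<in> C" using C_const[of 1] by simp
  have C_zero: "0 \<in> C" using C_const[of 0] by simp
  have C_sum: "sum f I \<in> C" if "\<And>i. i \<in> I \<Longrightarrow> f i \<in> C" for f :: "_ \<Rightarrow> 'a mpoly" and I :: "(nat \<Rightarrow>\<^sub>0 nat) set"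
    using that by (induction I rule: infinite_finite_induct) (auto intro: C_zero C_add)
  have C_prod: "prod f I \<in> C" if "\<And>i. i \<in> I \<Longrightarrow> f i \<in> C" for f :: "_ \<Rightarrow> 'a mpoly" and I :: "nat set"
    using that by (induction I rule: infinite_finite_induct) (auto intro: C_one C_mult)
  have C_power: "q ^ k \<in> C" if "q \<in> C" for q k
    by (induction k) (auto intro: C_one C_mult that)
  have "Poly_Mapping.single m c \<in> C" if "m \<in> Poly_Mapping.keys p" for m c
  proof -
    have "Poly_Mapping.single m (1::'a) =
        (\<Prod>i\<in>Poly_Mapping.keys m. mvar i ^ Poly_Mapping.lookup m i)"
      by (subst sum_single_superset[OF finite_keys order.refl, of m], subst single_sum_eq_prod,
          rule prod.cong[OF refl single_var_power])
    also have "\<dots> \<in> C" using that p by (intro C_prod C_power C_var) (auto simp: mpolys_over_def)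
    finally have "mconst c * Poly_Mapping.single m 1 \<in> C" by (intro C_mult C_const)
    then show ?thesis by (simp add: mult_single)
  qed
  then have "p \<in> C"
    by (subst sum_single_superset[OF finite_keys order.refl, of p]) (rule C_sum)
  then show ?thesis by (simp add: C_def)
qed

definition monomial_value :: "(nat \<Rightarrow> 'b::comm_ring_1) \<Rightarrow> (nat \<Rightarrow>\<^sub>0 nat) \<Rightarrow> 'b" where
  "monomial_value x m = (\<Prod>i\<in>Poly_Mapping.keys m. x i ^ Poly_Mapping.lookup m i)"

definition mpoly_eval :: "('a::comm_ring_1 \<Rightarrow> 'b::comm_ring_1) \<Rightarrow> (nat \<Rightarrow> 'b) \<Rightarrow> 'a mpoly \<Rightarrow> 'b" where
  "mpoly_eval \<phi> x p = (\<Sum>m\<in>Poly_Mapping.keys p. \<phi> (Poly_Mapping.lookup p m) * monomial_value x m)"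

definition unital_ring_hom :: "('a::comm_ring_1 \<Rightarrow> 'b::comm_ring_1) \<Rightarrow> bool" where
  "unital_ring_hom \<phi> \<longleftrightarrow> \<phi> 1 = 1 \<and> (\<forall>a b. \<phi> (a + b) = \<phi> a + \<phi> b \<and> \<phi> (a * b) = \<phi> a * \<phi> b)"

lemma unital_ring_hom_0: "unital_ring_hom \<phi> \<Longrightarrow> \<phi> 0 = 0"
  unfolding unital_ring_hom_def by (metis add_cancel_right_left)

lemma monomial_value_add: "monomial_value x (a + b) = monomial_value x a * monomial_value x b"
proof -
  let ?I = "Poly_Mapping.keys a \<union> Poly_Mapping.keys b"
  have "monomial_value x m = (\<Prod>i\<in>?I. x i ^ Poly_Mapping.lookup m i)"
    if "Poly_Mapping.keys m \<subseteq> ?I" for m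
    unfolding monomial_value_def using that
    by (intro prod.mono_neutral_left) (auto simp: in_keys_iff)
  from this[of a] this[of b] this[of "a + b"] show ?thesis
    using Poly_Mapping.keys_add[of a b]
    by (simp add: lookup_add power_add prod.distrib)
qed

lemma mpoly_eval_superset:
  assumes "\<phi> 0 = 0" "finite A" "Poly_Mapping.keys p \<subseteq> A"
  shows "mpoly_eval \<phi> x p = (\<Sum>m\<in>A. \<phi> (Poly_Mapping.lookup p m) * monomial_value x m)"
  unfolding mpoly_eval_def using assms by (intro sum.mono_neutral_left) (auto simp: in_keys_iff)

lemma mpoly_eval_single:
  assumes "\<phi> 0 = 0"
  shows "mpoly_eval \<phi> x (Poly_Mapping.single m c) = \<phi> c * monomial_value x m"
  using assms by (subst mpoly_eval_superset[of _ "{m}"]) auto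

lemma unital_ring_hom_mpoly_eval:
  assumes \<phi>: "unital_ring_hom \<phi>"
  shows "unital_ring_hom (mpoly_eval \<phi> x)"
proof -
  note zero = unital_ring_hom_0[OF \<phi>]
  have add: "mpoly_eval \<phi> x (p + q) = mpoly_eval \<phi> x p + mpoly_eval \<phi> x q" for p q
  proof -
    let ?A = "Poly_Mapping.keys p \<union> Poly_Mapping.keys q"
    have "mpoly_eval \<phi> x r = (\<Sum>m\<in>?A. \<phi> (Poly_Mapping.lookup r m) * monomial_value x m)"
      if "Poly_Mapping.keys r \<subseteq> ?A" for r
      using that by (intro mpoly_eval_superset zero) auto
    from this[of p] this[of q] this[of "p + q"] show ?thesis
      using \<phi> Poly_Mapping.keys_add[of p q]
      by (simp add: lookup_add unital_ring_hom_def sum.distrib algebra_simps)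
  qed
  have zero': "mpoly_eval \<phi> x 0 = 0" by (simp add: mpoly_eval_def)
  have sum: "mpoly_eval \<phi> x (sum f I) = (\<Sum>i\<in>I. mpoly_eval \<phi> x (f i))" for f and I :: "(nat \<Rightarrow>\<^sub>0 nat) set"
    by (induction I rule: infinite_finite_induct) (simp_all add: zero' add)
  have "mpoly_eval \<phi> x (p * q) = mpoly_eval \<phi> x p * mpoly_eval \<phi> x q" for p q
  proof -
    have "mpoly_eval \<phi> x (p * q) = (\<Sum>a\<in>Poly_Mapping.keys p. \<Sum>b\<in>Poly_Mapping.keys q.
        (\<phi> (Poly_Mapping.lookup p a) * \<phi> (Poly_Mapping.lookup q b)) * (monomial_value x a * monomial_value x b))"
      using \<phi> by (simp add: mult_sum_single[OF finite_keys order.refl finite_keys order.refl, of p q]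
          sum mpoly_eval_single[where \<phi> = \<phi>, OF zero] monomial_value_add unital_ring_hom_def)
    also have "\<dots> = mpoly_eval \<phi> x p * mpoly_eval \<phi> x q"
      by (simp add: mpoly_eval_def sum_product algebra_simps)
    finally show ?thesis .
  qed
  moreover have "mpoly_eval \<phi> x 1 = 1"
    using mpoly_eval_single[where \<phi> = \<phi>, OF zero, of x 0 1] \<phi> by (simp add: unital_ring_hom_def monomial_value_def)
  ultimately show ?thesis using add by (simp add: unital_ring_hom_def)
qed

lemma mpoly_eval_const: "unital_ring_hom \<phi> \<Longrightarrow> mpoly_eval \<phi> x (mconst c) = \<phi> c"
  by (simp add: mpoly_eval_single unital_ring_hom_0 monomial_value_def)

lemma mpoly_eval_var: "unital_ring_hom \<phi> \<Longrightarrow> mpoly_eval \<phi> x (mvar i) = x i"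
  using unital_ring_hom_0[of \<phi>]
  by (simp add: mpoly_eval_single monomial_value_def) (simp add: unital_ring_hom_def)

lemma mpoly_eval_in_ideal:
  assumes C: "is_subring C" and I: "0 \<in> I" "\<And>a b. a \<in> I \<Longrightarrow> b \<in> I \<Longrightarrow> a - b \<in> I"
    "\<And>a c. a \<in> I \<Longrightarrow> c \<in> C \<Longrightarrow> a * c \<in> I"
    and p: "p \<in> mpolys_over d I" and x: "\<And>i. i < d \<Longrightarrow> x i \<in> C"
  shows "mpoly_eval id x p \<in> I"
proof -
  have add: "a + b \<in> I" if "a \<in> I" "b \<in> I" for a b
    using I(2)[OF that(1) I(2)[OF I(1) that(2)]] by simp
  have prod: "prod f J \<in> C" if "\<And>i. i \<in> J \<Longrightarrow> f i \<in> C" for f :: "_ \<Rightarrow> 'a" and J :: "nat set"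
    using that by (induction J rule: infinite_finite_induct) (auto intro: subring_closed[OF C])
  have sum: "sum f J \<in> I" if "\<And>i. i \<in> J \<Longrightarrow> f i \<in> I" for f :: "_ \<Rightarrow> 'a" and J :: "(nat \<Rightarrow>\<^sub>0 nat) set"
    using that by (induction J rule: infinite_finite_induct) (auto intro: I(1) add)
  show ?thesis
    unfolding mpoly_eval_def
  proof (rule sum)
    fix m assume m: "m \<in> Poly_Mapping.keys p"
    have "monomial_value x m \<in> C"
      unfolding monomial_value_def
      by (rule prod, rule subring_power[OF C], rule x) (use m p in \<open>auto simp: mpolys_over_def\<close>)
    then show "id (Poly_Mapping.lookup p m) * monomial_value x m \<in> I"
      using p by (intro I(3)) (simp_all add: mpolys_over_def)
  qed
qed

section \<open>Differential operators from linear functionals\<close>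

lemma mpoly_ring_simps [simp]:
  "monoid.mult (mpoly_ring d) = (*)" "one (mpoly_ring d) = 1"
  "ring.zero (mpoly_ring d) = 0" "ring.add (mpoly_ring d) = (+)"
  by (simp_all add: mpoly_ring_def)

lemma mpoly_ring_minus:
  assumes "p \<in> carrier (mpoly_ring d)" "q \<in> carrier (mpoly_ring d)"
  shows "p \<ominus>\<^bsub>mpoly_ring d\<^esub> q = p - q"
proof -
  interpret domain "mpoly_ring d :: 'a mpoly ring" by (rule domain_mpoly_ring)
  have "- q \<in> carrier (mpoly_ring d)"
    using mpolys_over_diff[of UNIV 0 d q] mpolys_over_zero[of UNIV d] assms(2)
    by (simp add: carrier_mpoly_ring)
  then have "\<ominus>\<^bsub>mpoly_ring d\<^esub> q = - q" using assms(2) by (intro minus_equality) simp_all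
  then show ?thesis by (simp add: a_minus_def)
qed

lemma (in ring) linear_endos_int:
  "linear_endos \<Z> (\<lambda>k. add_pow R k \<one>) R = hom (add_monoid R) (add_monoid R)"
proof -
  have "\<delta> (add_pow R (k::int) \<one> \<otimes> x) = add_pow R k \<one> \<otimes> \<delta> x"
    if \<delta>: "\<delta> \<in> hom (add_monoid R) (add_monoid R)" and x: "x \<in> carrier R" for \<delta> k x
  proof -
    have \<delta>x: "\<delta> x \<in> carrier R" using \<delta> x by (auto simp: hom_def)
    interpret group_hom "add_monoid R" "add_monoid R" \<delta>
      using \<delta> a_group by (intro group_hom.intro group_hom_axioms.intro) auto
    have "\<delta> (add_pow R k x) = add_pow R k (\<delta> x)" using hom_int_pow[of x k] x by (simp add: add_pow_def)
    then show ?thesis using x \<delta>x by (simp add: add_pow_ldistr_int)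
  qed
  then show ?thesis by (auto simp: linear_endos_def)
qed

text \<open>
  The ring \<open>M 0\<close> plays the role of \<open>R\<^sub>Q\<close>, the map \<open>inc\<close> that of the localization map, and \<open>L\<close> that of a
  coefficient field modulo \<open>M n\<close>.
\<close>

locale filtered_overring = ideal_filtration M for M :: "nat \<Rightarrow> 'f::idom set" +
  fixes inc :: "'k::field mpoly \<Rightarrow> 'f" and d n :: nat and L :: "'f set"
  assumes inc_hom: "unital_ring_hom inc"
    and inc_M0: "r \<in> mpolys_over d UNIV \<Longrightarrow> inc r \<in> M 0"
    and n_pos: "n \<ge> 1" and subring_L: "is_subring L" and L_M0: "L \<subseteq> M 0"
    and L_M1: "L \<inter> M 1 \<subseteq> M n" and L_surj: "x \<in> M 0 \<Longrightarrow> \<exists>l\<in>L. x - l \<in> M 1"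
begin

abbreviation "R \<equiv> mpolys_over d (UNIV :: 'k set)"

lemma R_ring: "0 \<in> R" "1 \<in> R" "p \<in> R \<Longrightarrow> q \<in> R \<Longrightarrow> p + q \<in> R"
  "p \<in> R \<Longrightarrow> q \<in> R \<Longrightarrow> p - q \<in> R" "p \<in> R \<Longrightarrow> q \<in> R \<Longrightarrow> p * q \<in> R" "mconst c \<in> R"
proof -
  interpret domain "mpoly_ring d :: 'k mpoly ring" by (rule domain_mpoly_ring)
  show "0 \<in> R" "1 \<in> R" using zero_closed one_closed by (simp_all add: carrier_mpoly_ring)
  show "p \<in> R \<Longrightarrow> q \<in> R \<Longrightarrow> p + q \<in> R" "p \<in> R \<Longrightarrow> q \<in> R \<Longrightarrow> p * q \<in> R"
    using a_closed[of p q] m_closed[of p q] by (simp_all add: carrier_mpoly_ring)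
  show "p \<in> R \<Longrightarrow> q \<in> R \<Longrightarrow> p - q \<in> R"
    using minus_closed[of p q] by (simp add: mpoly_ring_minus[symmetric] carrier_mpoly_ring)
  show "mconst c \<in> R" by (intro mpolys_over_single) auto
qed

lemma inc_simps: "inc 0 = 0" "inc 1 = 1" "inc (p + q) = inc p + inc q" "inc (p * q) = inc p * inc q"
  using unital_ring_hom_0[OF inc_hom] inc_hom by (simp_all add: unital_ring_hom_def)

definition residue_rep :: "'f \<Rightarrow> 'f" where
  "residue_rep x = (SOME l. l \<in> L \<and> x - l \<in> M 1)"

lemma residue_rep:
  assumes "x \<in> M 0"
  shows "residue_rep x \<in> L" "x - residue_rep x \<in> M 1"
proof -
  have "\<exists>l. l \<in> L \<and> x - l \<in> M 1" using L_surj[OF assms] by blast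
  then have "residue_rep x \<in> L \<and> x - residue_rep x \<in> M 1"
    unfolding residue_rep_def by (rule someI_ex)
  then show "residue_rep x \<in> L" "x - residue_rep x \<in> M 1" by auto
qed

text \<open>
  This is the embedding \<open>s\<close> of \<open>K\<close> through the coefficient field. The value at \<open>0\<close> is set to \<open>0\<close>,
  which is a representative, so that applying \<open>const_rep\<close> to all coefficients is compatible with
  finite supports.
\<close>

definition const_rep :: "'k \<Rightarrow> 'f" where
  "const_rep c = (if c = 0 then 0 else residue_rep (inc (mconst c)))"

lemma const_rep_0 [simp]: "const_rep 0 = 0" by (simp add: const_rep_def)

lemma const_rep_L: "const_rep c \<in> L"
  using residue_rep(1)[OF inc_M0[OF R_ring(6)]] subring_zero[OF subring_L] by (auto simp: const_rep_def)

lemma const_rep_M0: "const_rep c \<in> M 0" using const_rep_L L_M0 by blast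

lemma const_rep_congruent: "inc (mconst c) - const_rep c \<in> M 1"
  using residue_rep(2)[OF inc_M0[OF R_ring(6)]] M_zero by (auto simp: const_rep_def inc_simps)

text \<open>
  An element of \<open>L\<close> is determined modulo \<open>M n\<close> by its residue class. This makes \<open>const_rep\<close> a ring
  homomorphism modulo \<open>M n\<close>.
\<close>

lemma const_rep_determined:
  assumes "x \<in> L" "inc (mconst c) - x \<in> M 1"
  shows "const_rep c - x \<in> M n"
proof -
  have "(inc (mconst c) - x) - (inc (mconst c) - const_rep c) \<in> M 1" by (intro M_diff assms const_rep_congruent)
  then have "const_rep c - x \<in> M 1" by simp
  moreover have "const_rep c - x \<in> L" by (intro subring_diff[OF subring_L] const_rep_L assms)
  ultimately show ?thesis using L_M1 by blast
qed

sublocale coeff: coefficient_space "M 0" "M n" const_rep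
proof
  show "is_subring (M 0)" by (rule subring_M0)
  show "M n \<subseteq> M 0" by (rule M_antimono) simp
  show "const_rep c \<in> M 0" for c by (rule const_rep_M0)
  show "const_rep (a + b) - const_rep a - const_rep b \<in> M n" for a b
  proof -
    have "(inc (mconst a) - const_rep a) + (inc (mconst b) - const_rep b) \<in> M 1" by (intro M_add const_rep_congruent)
    then have "const_rep (a + b) - (const_rep a + const_rep b) \<in> M n"
      by (intro const_rep_determined subring_add[OF subring_L] const_rep_L)
        (simp add: single_add inc_simps algebra_simps)
    then show ?thesis by (simp add: algebra_simps)
  qed
  show "const_rep (a * b) - const_rep a * const_rep b \<in> M n" for a b
  proof (rule const_rep_determined[OF subring_mult[OF subring_L const_rep_L const_rep_L]])
    have "inc (mconst a) * (inc (mconst b) - const_rep b) + const_rep b * (inc (mconst a) - const_rep a) \<in> M 1"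
      by (intro M_add M_mult0 const_rep_congruent inc_M0 R_ring const_rep_M0)
    moreover have "mconst (a * b) = mconst a * mconst b" by (simp add: mult_single)
    ultimately show "inc (mconst (a * b)) - const_rep a * const_rep b \<in> M 1"
      by (simp add: inc_simps algebra_simps)
  qed
  show "const_rep 1 - 1 \<in> M n"
    by (rule const_rep_determined[OF subring_one[OF subring_L]]) (simp add: inc_simps M_zero)
qed (simp_all add: M_zero M_diff M_mult0)

text \<open>
  Here \<open>x\<^sub>i = y\<^sub>i + t\<^sub>i\<close> with \<open>t\<^sub>i\<close> given by \<open>var_shift\<close> and \<open>y\<^sub>i\<close> by \<open>var_rep\<close>. The variables with index at
  least \<open>d\<close> need not map into \<open>M 0\<close>, and they are not shifted.
\<close>

definition var_shift :: "nat \<Rightarrow> 'f" where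
  "var_shift i = (if i < d then inc (mvar i) - residue_rep (inc (mvar i)) else 0)"

definition var_rep :: "nat \<Rightarrow> 'f" where
  "var_rep i = inc (mvar i) - var_shift i"

lemma mvar_R: "i < d \<Longrightarrow> mvar i \<in> R" by (intro mpolys_over_single) auto

lemma var_shift_M1: "var_shift i \<in> M 1"
  using residue_rep(2)[OF inc_M0[OF mvar_R]] M_zero by (simp add: var_shift_def)

lemma var_rep_L: "i < d \<Longrightarrow> var_rep i \<in> L"
  using residue_rep(1)[OF inc_M0[OF mvar_R]] by (simp add: var_rep_def var_shift_def)

text \<open>
  The homomorphism \<open>T\<close>: it expands a polynomial at the point \<open>(t\<^sub>1, \<dots>, t\<^sub>d)\<close>.
\<close>

definition taylor :: "'k mpoly \<Rightarrow> 'f mpoly" where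
  "taylor = mpoly_eval (\<lambda>c. mconst (inc (mconst c))) (\<lambda>i. mvar i + mconst (var_shift i))"

text \<open>
  The homomorphism \<open>S\<close>, which is additive and multiplicative only modulo \<open>M n\<close>. It equips
  \<open>M\<^sub>0[X\<^sub>1, \<dots>, X\<^sub>d] / M\<^sub>n[X\<^sub>1, \<dots>, X\<^sub>d]\<close> with an \<open>R\<close>-module structure.
\<close>

definition scalar :: "'k mpoly \<Rightarrow> 'f mpoly" where
  "scalar r = Poly_Mapping.map const_rep r"

lemma lookup_map_0: "\<phi> 0 = 0 \<Longrightarrow> Poly_Mapping.lookup (Poly_Mapping.map \<phi> p) m = \<phi> (Poly_Mapping.lookup p m)"
  by (simp add: map.rep_eq when_def)

lemma lookup_scalar: "Poly_Mapping.lookup (scalar r) m = const_rep (Poly_Mapping.lookup r m)"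
  by (simp add: scalar_def lookup_map_0)

lemma mconst_mult: "mconst (a * b) = mconst a * mconst b"
  by (simp add: mult_single)

lemma hom_const: "unital_ring_hom (\<lambda>c. mconst (inc (mconst c)) :: 'f mpoly)"
  by (simp add: unital_ring_hom_def inc_simps single_add mconst_mult)

lemma taylor_hom: "unital_ring_hom taylor" unfolding taylor_def by (rule unital_ring_hom_mpoly_eval[OF hom_const])

lemma taylor_simps: "taylor (p + q) = taylor p + taylor q" "taylor (p * q) = taylor p * taylor q"
  "taylor (mconst c) = mconst (inc (mconst c))"
  "taylor (mvar i) = mvar i + mconst (var_shift i)" "taylor 1 = 1"
  using taylor_hom mpoly_eval_const[OF hom_const] mpoly_eval_var[OF hom_const]
  by (simp_all add: unital_ring_hom_def taylor_def)

abbreviation G :: "nat \<Rightarrow> 'f mpoly set" where "G i \<equiv> mpolys_over d (M i)"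

lemma G_closed:
  shows "0 \<in> G i" and "p \<in> G i \<Longrightarrow> q \<in> G i \<Longrightarrow> p + q \<in> G i"
    and "p \<in> G i \<Longrightarrow> q \<in> G i \<Longrightarrow> p - q \<in> G i"
    and "(\<And>j. j \<in> J \<Longrightarrow> f j \<in> G i) \<Longrightarrow> sum f J \<in> G i"
    and "c \<in> M i \<Longrightarrow> Poly_Mapping.keys m \<subseteq> {..<d} \<Longrightarrow> Poly_Mapping.single m c \<in> G i"
  using M_zero M_diff
  by (blast intro: mpolys_over_zero mpolys_over_add mpolys_over_diff mpolys_over_sum mpolys_over_single)+

lemma G_mult: "p \<in> G i \<Longrightarrow> q \<in> G j \<Longrightarrow> p * q \<in> G (i + j)"
  by (rule mpolys_over_mult[OF M_zero M_diff M_mult])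

lemma G_antimono: "i \<le> j \<Longrightarrow> G j \<subseteq> G i"
  using M_antimono[of i j] unfolding mpolys_over_def by blast

lemma mconst_G: "c \<in> M i \<Longrightarrow> mconst c \<in> G i" by (rule G_closed) auto

text \<open>
  Both maps are compared with \<open>E\<close>, which embeds the coefficients without any modification. The
  difference of \<open>T\<close> and \<open>E\<close> lies in an ideal, so generators suffice; the difference of \<open>E\<close> and \<open>S\<close>
  is visible coefficientwise.
\<close>

lemma taylor_congruent:
  assumes "r \<in> R"
  shows "taylor r \<in> G 0" "taylor r - scalar r \<in> G 1"
proof -
  define E where "E r = (Poly_Mapping.map (\<lambda>c. inc (mconst c)) r :: 'f mpoly)" for r
  have lookup_E: "Poly_Mapping.lookup (E r) m = inc (mconst (Poly_Mapping.lookup r m))" for r m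
    unfolding E_def by (rule lookup_map_0) (simp add: inc_simps)
  have E_single: "E (Poly_Mapping.single m c) = Poly_Mapping.single m (inc (mconst c))" for m c
    unfolding E_def by (rule map_single) (simp add: inc_simps)
  have E_add: "E (p + q) = E p + E q" for p q
    by (rule poly_mapping_eqI) (simp add: lookup_E lookup_add single_add inc_simps)
  have E_0: "E 0 = 0" by (rule poly_mapping_eqI) (simp add: lookup_E inc_simps)
  have E_sum: "E (sum f I) = (\<Sum>i\<in>I. E (f i))" for f and I :: "(nat \<Rightarrow>\<^sub>0 nat) set"
    by (induction I rule: infinite_finite_induct) (simp_all add: E_0 E_add)
  have keys_E: "Poly_Mapping.keys (E p) \<subseteq> Poly_Mapping.keys p" for p
    by (auto simp: in_keys_iff lookup_E inc_simps)
  have E_mult: "E (p * q) = E p * E q" for p q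
  proof -
    show ?thesis
      by (simp add: mconst_mult mult_sum_single[OF finite_keys order.refl finite_keys order.refl, of p q]
          mult_sum_single[OF finite_keys keys_E finite_keys keys_E] E_sum E_single lookup_E inc_simps)
  qed
  have "taylor r \<in> G 0 \<and> taylor r - E r \<in> G 1 \<and> E r \<in> G 0"
    using assms
  proof (induction r rule: mpoly_induct)
    case (const c)
    then show ?case
      by (simp add: taylor_simps E_single G_closed(1) mconst_G inc_M0 R_ring)
  next
    case (var i)
    have "E (mvar i) = mvar i" by (simp add: E_single inc_simps)
    moreover have "(mvar i :: 'f mpoly) \<in> G 0" using var M0_closed(1) by (intro G_closed) auto
    moreover have "mconst (var_shift i) \<in> G 0" "mconst (var_shift i) \<in> G 1"
      using var_shift_M1 M_antimono[of 0 1] by (auto intro!: mconst_G)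
    ultimately show ?case unfolding taylor_simps using G_closed(2) by simp
  next
    case (add p q)
    have "(taylor p - E p) + (taylor q - E q) \<in> G 1" using add by (intro G_closed(2)) auto
    then show ?case using add G_closed(2) by (simp add: taylor_simps E_add algebra_simps)
  next
    case (mult p q)
    have "taylor p * (taylor q - E q) \<in> G (0 + 1)" "E q * (taylor p - E p) \<in> G (0 + 1)" "taylor p * taylor q \<in> G (0 + 0)"
      "E p * E q \<in> G (0 + 0)"
      by (rule G_mult; use mult in simp)+
    moreover from this have "taylor p * (taylor q - E q) + E q * (taylor p - E p) \<in> G 1" by (intro G_closed(2)) simp_all
    ultimately show ?case by (simp add: taylor_simps E_mult algebra_simps)
  qed
  moreover have "E r - scalar r \<in> G 1"
  proof -
    have "Poly_Mapping.keys m \<subseteq> {..<d}" if "m \<in> Poly_Mapping.keys (E r - scalar r)" for m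
    proof -
      have "m \<in> Poly_Mapping.keys r"
        using that by (cases "Poly_Mapping.lookup r m = 0")
          (simp_all add: in_keys_iff lookup_minus lookup_E lookup_scalar inc_simps)
      then show ?thesis using assms by (simp add: mpolys_over_def)
    qed
    then show ?thesis
      using const_rep_congruent by (simp add: mpolys_over_def lookup_minus lookup_E scalar_def lookup_map_0)
  qed
  ultimately show "taylor r \<in> G 0" "taylor r - scalar r \<in> G 1" using G_closed(2)[of "taylor r - E r" 1 "E r - scalar r"] by auto
qed

lemma scalar_G0: "r \<in> R \<Longrightarrow> scalar r \<in> G 0"
  using G_closed(3)[of "taylor r" 0 "taylor r - scalar r"] taylor_congruent[of r] G_antimono[of 0 1] by auto

lemma functional_0: "coeff.functional \<mu> \<Longrightarrow> \<mu> 0 = 0"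
  using M_zero by (simp add: coeff.functional_def)

lemma map_functional_R: "coeff.functional \<mu> \<Longrightarrow> h \<in> G i \<Longrightarrow> Poly_Mapping.map \<mu> h \<in> R"
  by (auto simp: mpolys_over_def in_keys_iff lookup_map_0 functional_0)

lemma map_functional_add:
  assumes "coeff.functional \<mu>" "g \<in> G 0" "h \<in> G 0"
  shows "Poly_Mapping.map \<mu> (g + h) = Poly_Mapping.map \<mu> g + Poly_Mapping.map \<mu> h"
  using assms by (intro poly_mapping_eqI)
    (simp add: lookup_map_0 functional_0 lookup_add mpolys_over_def coeff.functional_def)

lemma map_functional_kernel:
  assumes "coeff.functional \<mu>" "h \<in> G n"
  shows "Poly_Mapping.map \<mu> h = 0"
  using assms by (intro poly_mapping_eqI)
    (simp add: lookup_map_0 functional_0 mpolys_over_def coeff.functional_def)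

text \<open>
  A functional applied to coefficients is linear over \<open>R\<close> when \<open>R\<close> acts through \<open>S\<close>.
\<close>

lemma map_functional_scalar:
  assumes \<mu>: "coeff.functional \<mu>" and r: "r \<in> R" and h: "h \<in> G 0"
  shows "Poly_Mapping.map \<mu> (scalar r * h) = r * Poly_Mapping.map \<mu> h"
proof -
  let ?A = "Poly_Mapping.keys r" and ?B = "Poly_Mapping.keys h"
  have kS: "Poly_Mapping.keys (scalar r) \<subseteq> ?A" by (auto simp: in_keys_iff scalar_def lookup_map_0)
  have k\<mu>: "Poly_Mapping.keys (Poly_Mapping.map \<mu> h) \<subseteq> ?B"
    using functional_0[OF \<mu>] by (auto simp: in_keys_iff lookup_map_0)
  have sum: "Poly_Mapping.map \<mu> (sum f I) = (\<Sum>i\<in>I. Poly_Mapping.map \<mu> (f i))"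
    if "\<And>i. i \<in> I \<Longrightarrow> f i \<in> G 0" for f and I :: "(nat \<Rightarrow>\<^sub>0 nat) set"
    using that
  proof (induction I rule: infinite_finite_induct)
    case (insert i I)
    then show ?case using map_functional_add[OF \<mu>, of "f i" "sum f I"] G_closed(4)[of I f 0] by simp
  qed (simp_all add: map_functional_kernel[OF \<mu> G_closed(1)])
  define c where "c a b = const_rep (Poly_Mapping.lookup r a) * Poly_Mapping.lookup h b" for a b
  have hb: "Poly_Mapping.lookup h b \<in> M 0" for b using h by (simp add: mpolys_over_def)
  have c: "Poly_Mapping.single (a + b) (c a b) \<in> G 0" if "a \<in> ?A" "b \<in> ?B" for a b
  proof (rule G_closed(5))
    show "c a b \<in> M 0" unfolding c_def using const_rep_M0 hb M0_closed(4) by blast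
    show "Poly_Mapping.keys (a + b) \<subseteq> {..<d}"
      using that r h Poly_Mapping.keys_add[of a b] unfolding mpolys_over_def by blast
  qed
  have "Poly_Mapping.map \<mu> (scalar r * h) = Poly_Mapping.map \<mu> (\<Sum>a\<in>?A. \<Sum>b\<in>?B. Poly_Mapping.single (a + b) (c a b))"
    unfolding mult_sum_single[OF finite_keys kS finite_keys order.refl]
    by (simp add: c_def lookup_map_0 scalar_def)
  also have "\<dots> = (\<Sum>a\<in>?A. Poly_Mapping.map \<mu> (\<Sum>b\<in>?B. Poly_Mapping.single (a + b) (c a b)))"
    by (intro sum G_closed(4) c)
  also have "\<dots> = (\<Sum>a\<in>?A. \<Sum>b\<in>?B. Poly_Mapping.map \<mu> (Poly_Mapping.single (a + b) (c a b)))"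
    by (intro sum.cong refl sum c)
  also have "\<dots> = (\<Sum>a\<in>?A. \<Sum>b\<in>?B. Poly_Mapping.single (a + b) (\<mu> (c a b)))"
    using functional_0[OF \<mu>] by (intro sum.cong refl map_single) simp
  also have "\<dots> = (\<Sum>a\<in>?A. \<Sum>b\<in>?B. Poly_Mapping.single (a + b)
      (Poly_Mapping.lookup r a * Poly_Mapping.lookup (Poly_Mapping.map \<mu> h) b))"
    using \<mu> hb by (simp add: c_def coeff.functional_def lookup_map_0 functional_0[OF \<mu>])
  also have "\<dots> = r * Poly_Mapping.map \<mu> h"
    by (rule mult_sum_single[OF finite_keys order.refl finite_keys k\<mu>, symmetric])
  finally show ?thesis .
qed

lemma map_functional_diff:
  assumes "coeff.functional \<mu>" "g \<in> G 0" "h \<in> G 0"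
  shows "Poly_Mapping.map \<mu> (g - h) = Poly_Mapping.map \<mu> g - Poly_Mapping.map \<mu> h"
  using map_functional_add[OF assms(1) G_closed(3)[OF assms(2,3)] assms(3)] by simp

text \<open>
  The factor \<open>z\<close> is what makes the induction work: the commutator of the operator with
  multiplication by \<open>r\<close> has the factor \<open>z (T(r) - S(r))\<close>, which lies one step deeper in the
  filtration. At depth \<open>n - 1\<close> this product has coefficients in \<open>M\<^sub>n\<close>, where \<open>\<mu>\<close> vanishes, so the operator
  is \<open>R\<close>-linear.
\<close>

proposition functional_diff_op:
  assumes \<mu>: "coeff.functional \<mu>" and "n = Suc (k + i)" and "z \<in> G i"
    and "\<And>g. g \<in> R \<Longrightarrow> \<delta> g = Poly_Mapping.map \<mu> (z * taylor g)"
  shows "\<delta> \<in> diff_ops_int (mpoly_ring d) k"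
  using assms(2-)
proof (induction k arbitrary: i z \<delta>)
  have closed: "z * taylor g \<in> G i" if "z \<in> G i" "g \<in> R" for i z g
    using G_mult[OF that(1) taylor_congruent(1)[OF that(2)]] by simp
  have closed0: "z * taylor g \<in> G 0" if "z \<in> G i" "g \<in> R" for i z g
    using closed[OF that] G_antimono[of 0 i] by auto
  have hom: "\<delta> \<in> hom (add_monoid (mpoly_ring d)) (add_monoid (mpoly_ring d))"
    if "z \<in> G i" "\<And>g. g \<in> R \<Longrightarrow> \<delta> g = Poly_Mapping.map \<mu> (z * taylor g)" for z i \<delta>
  proof -
    have "\<delta> (g + h) = \<delta> g + \<delta> h" if gh: "g \<in> R" "h \<in> R" for g h
      using map_functional_add[OF \<mu> closed0[OF \<open>z \<in> G i\<close> gh(1)] closed0[OF \<open>z \<in> G i\<close> gh(2)]] that R_ring(3)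
      by (simp add: \<open>\<And>g. g \<in> R \<Longrightarrow> \<delta> g = _\<close> taylor_simps distrib_left)
    moreover have "\<delta> g \<in> R" if "g \<in> R" for g
      using map_functional_R[OF \<mu> closed[OF \<open>z \<in> G i\<close> that]] \<open>\<And>g. g \<in> R \<Longrightarrow> \<delta> g = _\<close>[OF that] by simp
    ultimately show ?thesis by (auto simp: hom_def carrier_mpoly_ring)
  qed
  have commutator: "Poly_Mapping.map \<mu> (z * taylor (r * g)) - r * Poly_Mapping.map \<mu> (z * taylor g)
      = Poly_Mapping.map \<mu> ((z * (taylor r - scalar r)) * taylor g)"
    and commutator_G: "z * (taylor r - scalar r) \<in> G (Suc i)"
    if z: "z \<in> G i" and rg: "r \<in> R" "g \<in> R" for z i r g
  proof -
    show "z * (taylor r - scalar r) \<in> G (Suc i)" using G_mult[OF z taylor_congruent(2)[OF rg(1)]] by simp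
    have 1: "z * taylor g \<in> G 0" by (rule closed0[OF z rg(2)])
    have 2: "scalar r * (z * taylor g) \<in> G 0" using G_mult[OF scalar_G0[OF rg(1)] 1] by simp
    have 3: "z * taylor (r * g) \<in> G 0" using rg by (intro closed0[OF z] R_ring)
    have "z * taylor (r * g) - scalar r * (z * taylor g) = (z * (taylor r - scalar r)) * taylor g"
      by (simp add: taylor_simps algebra_simps)
    then show "Poly_Mapping.map \<mu> (z * taylor (r * g)) - r * Poly_Mapping.map \<mu> (z * taylor g)
      = Poly_Mapping.map \<mu> ((z * (taylor r - scalar r)) * taylor g)"
      using map_functional_diff[OF \<mu> 3 2] map_functional_scalar[OF \<mu> rg(1) 1] by simp
  qed
  interpret R: domain "mpoly_ring d :: 'k mpoly ring" by (rule domain_mpoly_ring)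
  {
    case 0
    have "\<delta> (r * g) = r * \<delta> g" if "r \<in> R" "g \<in> R" for r g
    proof -
      have "(z * (taylor r - scalar r)) * taylor g \<in> G n"
        using closed[OF commutator_G[OF 0(2) that] that(2)] 0(1) by simp
      then have "Poly_Mapping.map \<mu> ((z * (taylor r - scalar r)) * taylor g) = 0" by (rule map_functional_kernel[OF \<mu>])
      then show ?thesis using commutator[OF 0(2) that] 0(3) that R_ring(5) by simp
    qed
    then show ?case using hom[OF 0(2,3)]
      by (simp add: diff_ops_int_def linear_endos_def carrier_mpoly_ring)
  next
    case (Suc k)
    have "(\<lambda>g. \<delta> (r * g) \<ominus>\<^bsub>mpoly_ring d\<^esub> r * \<delta> g) \<in> diff_ops_int (mpoly_ring d) k" if r: "r \<in> R" for r
    proof (rule Suc.IH[of "Suc i" "z * (taylor r - scalar r)"])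
      show "n = Suc (k + Suc i)" using Suc.prems(1) by simp
      show "z * (taylor r - scalar r) \<in> G (Suc i)" by (rule commutator_G[OF Suc.prems(2) r R_ring(1)])
      fix g assume g: "g \<in> R"
      have "\<delta> (r * g) \<in> R" "r * \<delta> g \<in> R"
        using map_functional_R[OF \<mu> closed[OF Suc.prems(2)]] Suc.prems(3) r g R_ring(5) by auto
      then show "\<delta> (r * g) \<ominus>\<^bsub>mpoly_ring d\<^esub> r * \<delta> g = Poly_Mapping.map \<mu> ((z * (taylor r - scalar r)) * taylor g)"
        using commutator[OF Suc.prems(2) r g] Suc.prems(3) r g R_ring(5)
        by (simp add: mpoly_ring_minus carrier_mpoly_ring)
    qed
    then show ?case
      using hom[OF Suc.prems(2,3)]
      by (simp add: diff_ops_int_def R.linear_endos_int[simplified] carrier_mpoly_ring)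
  }
qed

text \<open>
  Evaluation at \<open>(y\<^sub>1, \<dots>, y\<^sub>d)\<close>. It inverts \<open>T\<close> because \<open>y\<^sub>i + t\<^sub>i = x\<^sub>i\<close>.
\<close>

definition ev :: "'f mpoly \<Rightarrow> 'f" where "ev = mpoly_eval id var_rep"

lemma hom_id: "unital_ring_hom id" by (simp add: unital_ring_hom_def)

lemma ev_simps: "ev (p + q) = ev p + ev q" "ev (p * q) = ev p * ev q" "ev (mconst c) = c"
  "ev (mvar i) = var_rep i" "ev 0 = 0"
  using unital_ring_hom_mpoly_eval[OF hom_id, of var_rep] mpoly_eval_const[OF hom_id, of var_rep]
    mpoly_eval_var[OF hom_id, of var_rep]
  by (simp_all add: ev_def unital_ring_hom_def unital_ring_hom_0)

lemma ev_diff: "ev (p - q) = ev p - ev q" using ev_simps(1)[of "p - q" q] by simp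

lemma var_rep_M0: "i < d \<Longrightarrow> var_rep i \<in> M 0" using var_rep_L L_M0 by blast

lemma ev_G: "p \<in> G i \<Longrightarrow> ev p \<in> M i"
  unfolding ev_def
  by (rule mpoly_eval_in_ideal[OF subring_M0 M_zero M_diff _ _ var_rep_M0])
    (simp_all add: M_mult[of _ i _ 0, simplified])

lemma ev_taylor: "r \<in> R \<Longrightarrow> ev (taylor r) = inc r"
proof (induction r rule: mpoly_induct)
  case (var i)
  show ?case unfolding taylor_simps ev_simps var_rep_def by simp
qed (simp_all add: taylor_simps ev_simps inc_simps)

text \<open>
  The value of \<open>S(r)\<close> lies in \<open>L\<close> and is congruent to \<open>r\<close> modulo \<open>M\<^sub>1\<close>. So for \<open>r \<in> Q\<close> it lies in
  \<open>L \<inter> M\<^sub>1\<close>, hence in \<open>M\<^sub>n\<close>.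
\<close>

lemma ev_scalar:
  assumes r: "r \<in> R" "inc r \<in> M 1"
  shows "ev (scalar r) \<in> M n"
proof -
  have "scalar r \<in> mpolys_over d L"
    using scalar_G0[OF r(1)] const_rep_L by (simp add: mpolys_over_def scalar_def lookup_map_0)
  then have "ev (scalar r) \<in> L"
    unfolding ev_def
    by (intro mpoly_eval_in_ideal[OF subring_L _ _ _ _ var_rep_L] subring_closed[OF subring_L])
  moreover have "inc r - ev (taylor r - scalar r) \<in> M 1"
    using ev_G[OF taylor_congruent(2)[OF r(1)]] r(2) by (intro M_diff)
  then have "ev (scalar r) \<in> M 1" by (simp add: ev_diff ev_taylor[OF r(1)])
  ultimately show ?thesis using L_M1 by blast
qed

text \<open>
  The coefficients of \<open>T(f)\<close> are reproduced by finitely many functionals. Collected over all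
  monomials, this writes \<open>T(f)\<close> modulo \<open>M\<^sub>n\<close> as a combination of the polynomials \<open>S(\<delta> f)\<close> for operators
  \<open>\<delta>\<close> of order at most \<open>n - 1\<close>, and evaluation sends each of these into \<open>M\<^sub>n\<close>.
\<close>

proposition mem_Mn_if_diff_ops:
  assumes f: "f \<in> R" and \<delta>: "\<And>\<delta>. \<delta> \<in> diff_ops_int (mpoly_ring d) (n - 1) \<Longrightarrow> inc (\<delta> f) \<in> M 1"
  shows "inc f \<in> M n"
proof -
  \<comment> \<open>The vector \<open>0\<close> accounts for the monomials outside the support of \<open>T(f)\<close>.\<close>
  let ?B = "insert 0 (Poly_Mapping.lookup (taylor f) ` Poly_Mapping.keys (taylor f))"
  have TG: "taylor f \<in> G 0" by (rule taylor_congruent(1)[OF f])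
  have "?B \<subseteq> M 0" using TG M_zero by (auto simp: mpolys_over_def)
  then obtain ws where ws: "\<forall>(\<mu>, w)\<in>set ws. coeff.functional \<mu> \<and> w \<in> M 0"
    and dual: "\<forall>v\<in>?B. v - coeff.combine ws v \<in> M n"
    using coeff.ex_dual_family[of ?B] by auto
  define h where "h us = (\<Sum>(\<mu>, w)\<leftarrow>us. mconst w * scalar (Poly_Mapping.map \<mu> (taylor f)))" for us
  have h_G: "h us \<in> G 0" and ev_h: "ev (h us) \<in> M n"
    and lookup_h: "Poly_Mapping.lookup (h us) m = coeff.combine us (Poly_Mapping.lookup (taylor f) m)"
    if "\<forall>(\<mu>, w)\<in>set us. coeff.functional \<mu> \<and> w \<in> M 0" for us m
  proof -
    have "h us \<in> G 0 \<and> ev (h us) \<in> M n \<and>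
        Poly_Mapping.lookup (h us) m = coeff.combine us (Poly_Mapping.lookup (taylor f) m)"
      using that
    proof (induction us)
      case Nil
      then show ?case by (simp add: h_def coeff.combine_def ev_simps M_zero G_closed(1))
    next
      case (Cons u us)
      obtain \<mu> w where u: "u = (\<mu>, w)" by fastforce
      then have \<mu>: "coeff.functional \<mu>" and w: "w \<in> M 0" using Cons.prems by auto
      let ?g = "Poly_Mapping.map \<mu> (taylor f)"
      have g: "?g \<in> R" by (rule map_functional_R[OF \<mu> TG])
      have h: "h (u # us) = mconst w * scalar ?g + h us" by (simp add: h_def u)
      have "(\<lambda>g. Poly_Mapping.map \<mu> (1 * taylor g)) \<in> diff_ops_int (mpoly_ring d) (n - 1)"
        using n_pos mconst_G[OF M0_closed(1)] by (intro functional_diff_op[OF \<mu>, of _ 0 1]) auto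
      then have "inc ?g \<in> M 1" using \<delta> by fastforce
      then have "w * ev (scalar ?g) \<in> M n" by (intro M_mult0 w ev_scalar g)
      then have "ev (h (u # us)) \<in> M n" using Cons by (simp add: h ev_simps M_add)
      moreover have "h (u # us) \<in> G 0"
        using Cons G_mult[OF mconst_G[OF w] scalar_G0[OF g]] by (simp add: h G_closed(2))
      moreover have "Poly_Mapping.lookup (mconst w * scalar ?g) m = w * const_rep (\<mu> (Poly_Mapping.lookup (taylor f) m))"
        by (simp add: scalar_def lookup_map_0 functional_0[OF \<mu>] flip: mult_map_scale_conv_mult)
      ultimately show ?case using Cons by (simp add: h[unfolded u] lookup_add coeff.combine_def u mult.commute)
    qed
    then show "h us \<in> G 0" "ev (h us) \<in> M n"
      "Poly_Mapping.lookup (h us) m = coeff.combine us (Poly_Mapping.lookup (taylor f) m)" by auto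
  qed
  have "taylor f - h ws \<in> G n"
  proof -
    have "Poly_Mapping.lookup (taylor f - h ws) m \<in> M n" for m
      using dual by (cases "m \<in> Poly_Mapping.keys (taylor f)") (auto simp: lookup_minus lookup_h[OF ws] in_keys_iff)
    moreover have "taylor f - h ws \<in> G 0" by (intro G_closed(3) TG h_G ws)
    ultimately show ?thesis by (simp add: mpolys_over_def)
  qed
  then have "ev (taylor f - h ws) + ev (h ws) \<in> M n" by (intro M_add ev_G ev_h ws)
  then show ?thesis by (simp add: ev_diff ev_taylor[OF f])
qed

end

section \<open>The localization at a prime\<close>

locale mpoly_prime =
  fixes Q :: "'k::field mpoly set" and d :: nat
  assumes prime_Q: "primeideal Q (mpoly_ring d)"
begin

sublocale R: domain "mpoly_ring d :: 'k mpoly ring" by (rule domain_mpoly_ring)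
sublocale Q: primeideal Q "mpoly_ring d" by (rule prime_Q)

definition power_Q :: "nat \<Rightarrow> 'k mpoly set" where
  "power_Q j = Q [^]\<^bsub>ideals_set (mpoly_ring d)\<^esub> j"

definition fractions :: "nat \<Rightarrow> 'k mpoly fract set" where
  "fractions j = {to_fract a / to_fract s | a s. a \<in> power_Q j \<and> s \<in> carrier (mpoly_ring d) - Q}"

lemma power_Q_0: "power_Q 0 = carrier (mpoly_ring d)"
  unfolding power_Q_def by (rule ideal_power_0)

lemma power_Q_1: "power_Q 1 = Q"
proof
  show "power_Q 1 \<subseteq> Q"
    using R.ideal_power_Suc_subset[OF Q.ideal_axioms, of 0] by (simp add: power_Q_def)
  show "Q \<subseteq> power_Q 1"
  proof
    fix q assume "q \<in> Q"
    then have "1 \<otimes>\<^bsub>mpoly_ring d\<^esub> q \<in> ideal_prod (mpoly_ring d) (power_Q 0) Q"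
      using R.one_closed by (intro ideal_prod.prod) (simp_all add: power_Q_0)
    then show "q \<in> power_Q 1" unfolding power_Q_def One_nat_def ideal_power_Suc by simp
  qed
qed

lemmas power_Q_Suc_0 = power_Q_1[unfolded One_nat_def]

lemma power_Q_closed:
  shows "a \<in> power_Q j \<Longrightarrow> a \<in> carrier (mpoly_ring d)" and "0 \<in> power_Q j"
    and "a \<in> power_Q j \<Longrightarrow> b \<in> power_Q j \<Longrightarrow> a - b \<in> power_Q j"
    and "a \<in> power_Q j \<Longrightarrow> r \<in> carrier (mpoly_ring d) \<Longrightarrow> a * r \<in> power_Q j"
    and "a \<in> power_Q i \<Longrightarrow> b \<in> power_Q j \<Longrightarrow> a * b \<in> power_Q (i + j)"
    and "power_Q (Suc j) \<subseteq> power_Q j"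
proof -
  interpret I: ideal "power_Q j" "mpoly_ring d"
    unfolding power_Q_def by (rule R.ideal_power[OF Q.ideal_axioms])
  show "a \<in> power_Q j \<Longrightarrow> a \<in> carrier (mpoly_ring d)" by (rule I.Icarr)
  show "0 \<in> power_Q j" using I.zero_closed by simp
  show "a \<in> power_Q j \<Longrightarrow> b \<in> power_Q j \<Longrightarrow> a - b \<in> power_Q j"
    using I.a_closed[of a "\<ominus>\<^bsub>mpoly_ring d\<^esub> b"] I.a_inv_closed[of b] mpoly_ring_minus[of a d b] I.Icarr
    by (simp add: a_minus_def)
  show "a \<in> power_Q j \<Longrightarrow> r \<in> carrier (mpoly_ring d) \<Longrightarrow> a * r \<in> power_Q j"
    using I.I_r_closed[of a r] by simp
  show "a \<in> power_Q i \<Longrightarrow> b \<in> power_Q j \<Longrightarrow> a * b \<in> power_Q (i + j)"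
    using R.ideal_power_add[OF Q.ideal_axioms, of a i b j] by (simp add: power_Q_def)
  show "power_Q (Suc j) \<subseteq> power_Q j"
    using R.ideal_power_Suc_subset[OF Q.ideal_axioms, of j] by (simp add: power_Q_def)
qed

lemma denominators:
  shows "1 \<in> carrier (mpoly_ring d) - Q"
    and "s \<in> carrier (mpoly_ring d) - Q \<Longrightarrow> t \<in> carrier (mpoly_ring d) - Q \<Longrightarrow> s * t \<in> carrier (mpoly_ring d) - Q"
    and "s \<in> carrier (mpoly_ring d) - Q \<Longrightarrow> s \<noteq> 0"
proof -
  show "1 \<in> carrier (mpoly_ring d) - Q"
    using Q.one_imp_carrier Q.I_notcarr R.one_closed by auto
  show "s \<in> carrier (mpoly_ring d) - Q \<Longrightarrow> t \<in> carrier (mpoly_ring d) - Q \<Longrightarrow> s * t \<in> carrier (mpoly_ring d) - Q"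
    using Q.I_prime[of s t] R.m_closed[of s t] by auto
  show "s \<in> carrier (mpoly_ring d) - Q \<Longrightarrow> s \<noteq> 0" using Q.zero_closed by auto
qed

lemma fractionsI:
  "a \<in> power_Q j \<Longrightarrow> s \<in> carrier (mpoly_ring d) - Q \<Longrightarrow> to_fract a / to_fract s \<in> fractions j"
  unfolding fractions_def by blast

lemma to_fract_fractions: "a \<in> power_Q j \<Longrightarrow> to_fract a \<in> fractions j"
  using fractionsI[of a j 1] denominators(1) by simp

lemma fractionsE:
  assumes "x \<in> fractions j"
  obtains a s where "x = to_fract a / to_fract s" "a \<in> power_Q j" "s \<in> carrier (mpoly_ring d) - Q" "s \<noteq> 0"
  using assms denominators(3) unfolding fractions_def by blast

lemma mem_power_Q_if_fraction:
  assumes "to_fract f \<in> fractions j"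
  obtains s where "s \<in> carrier (mpoly_ring d) - Q" "s * f \<in> power_Q j"
proof -
  obtain a s where as: "to_fract f = to_fract a / to_fract s" "a \<in> power_Q j"
    "s \<in> carrier (mpoly_ring d) - Q" "s \<noteq> 0" using fractionsE[OF assms] by metis
  then have "to_fract (s * f) = to_fract a" by (simp add: field_simps)
  then have "s * f = a" by (simp only: to_fract_eq_iff)
  then show thesis using as that by blast
qed

text \<open>
  The residue characteristic is right because \<open>R\<^sub>Q\<close> contains the field \<open>K\<close>: a nonzero multiple of
  \<open>1\<close> in \<open>K\<close> is a unit and cannot lie in the maximal ideal.
\<close>

sublocale ideal_filtration fractions
proof
  have diff: "x - y \<in> fractions i" if xy: "x \<in> fractions i" "y \<in> fractions i" for x y i
  proof -
    obtain a s where x: "x = to_fract a / to_fract s" "a \<in> power_Q i" "s \<in> carrier (mpoly_ring d) - Q" "s \<noteq> 0"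
      using fractionsE[OF xy(1)] by metis
    obtain b t where y: "y = to_fract b / to_fract t" "b \<in> power_Q i" "t \<in> carrier (mpoly_ring d) - Q" "t \<noteq> 0"
      using fractionsE[OF xy(2)] by metis
    have "x - y = to_fract (a * t - b * s) / to_fract (s * t)"
      using x(4) y(4) by (simp add: x(1) y(1) field_simps)
    moreover have "a * t - b * s \<in> power_Q i" using x y by (intro power_Q_closed(3,4)) auto
    ultimately show ?thesis using fractionsI denominators(2)[OF x(3) y(3)] by metis
  qed
  then show "x \<in> fractions i \<Longrightarrow> y \<in> fractions i \<Longrightarrow> x - y \<in> fractions i" for x y i .
  have mult: "x * y \<in> fractions (i + j)" if xy: "x \<in> fractions i" "y \<in> fractions j" for x y i j
  proof -
    obtain a s where x: "x = to_fract a / to_fract s" "a \<in> power_Q i" "s \<in> carrier (mpoly_ring d) - Q"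
      using fractionsE[OF xy(1)] by metis
    obtain b t where y: "y = to_fract b / to_fract t" "b \<in> power_Q j" "t \<in> carrier (mpoly_ring d) - Q"
      using fractionsE[OF xy(2)] by metis
    have "x * y = to_fract (a * b) / to_fract (s * t)" by (simp add: x(1) y(1))
    then show ?thesis using fractionsI power_Q_closed(5)[OF x(2) y(2)] denominators(2)[OF x(3) y(3)] by metis
  qed
  then show "x \<in> fractions i \<Longrightarrow> y \<in> fractions j \<Longrightarrow> x * y \<in> fractions (i + j)" for x y i j .
  have one: "1 \<in> fractions 0" using to_fract_fractions[of 1 0] R.one_closed by (simp add: power_Q_0)
  show "is_subring (fractions 0)"
    unfolding is_subring_def using one diff mult[of _ 0 _ 0] by simp
  show "0 \<in> fractions i" for i using to_fract_fractions[OF power_Q_closed(2)] by simp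
  show "fractions (Suc i) \<subseteq> fractions i" for i
    using power_Q_closed(6) unfolding fractions_def by blast
  show one1: "1 \<notin> fractions 1"
  proof
    assume "1 \<in> fractions 1"
    then obtain s where "s \<in> carrier (mpoly_ring d) - Q" "s * 1 \<in> power_Q 1"
      using mem_power_Q_if_fraction[of 1 1] by auto
    then show False by (simp add: power_Q_Suc_0)
  qed
  show "\<exists>y\<in>fractions 0. x * y = 1" if x: "x \<in> fractions 0" "x \<notin> fractions 1" for x
  proof -
    obtain a s where as: "x = to_fract a / to_fract s" "a \<in> power_Q 0" "s \<in> carrier (mpoly_ring d) - Q" "s \<noteq> 0"
      using fractionsE[OF x(1)] by metis
    have "a \<notin> Q" using fractionsI[of a 1 s] x(2) as(1,3) by (auto simp: power_Q_Suc_0)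
    then have a: "a \<in> carrier (mpoly_ring d) - Q" using as(2) by (simp add: power_Q_0)
    then have "to_fract s / to_fract a \<in> fractions 0" using as(3) by (intro fractionsI) (simp_all add: power_Q_0)
    moreover have "x * (to_fract s / to_fract a) = 1" using as(4) denominators(3)[OF a] by (simp add: as(1))
    ultimately show ?thesis by blast
  qed
  show "CHAR('k mpoly fract) dvd r" if r: "of_nat r \<in> fractions 1" for r
  proof -
    let ?c = "of_nat r :: 'k"
    have of_nat: "of_nat r = to_fract (mconst ?c)" by (induction r) (simp_all add: single_add)
    have "?c = 0"
    proof (rule ccontr)
      assume "?c \<noteq> 0"
      then have "mconst ?c * mconst (inverse ?c) = 1" by (simp add: mult_single del: single_of_nat)
      then have "to_fract (mconst ?c) * to_fract (mconst (inverse ?c)) = 1"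
        by (metis to_fract_mult to_fract_1)
      moreover have "to_fract (mconst (inverse ?c)) \<in> fractions 0"
        by (rule to_fract_fractions) (simp add: power_Q_0 carrier_mpoly_ring mpolys_over_single)
      ultimately show False using mult[OF r, of "to_fract (mconst (inverse ?c))" 0] one1 by (simp add: of_nat)
    qed
    then have "of_nat r = (0 :: 'k mpoly fract)" using of_nat by simp
    then show ?thesis by (simp only: of_nat_eq_0_iff_char_dvd)
  qed
qed

proposition mem_symbolic_power_if_diff_ops:
  assumes n: "n \<ge> 1" and f: "f \<in> carrier (mpoly_ring d)"
    and \<delta>: "\<And>\<delta>. \<delta> \<in> diff_ops_int (mpoly_ring d) (n - 1) \<Longrightarrow> \<delta> f \<in> Q"
  shows "f \<in> symbolic_power (mpoly_ring d) Q n"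
proof -
  obtain L where L: "is_subring L" "L \<subseteq> fractions 0" "L \<inter> fractions 1 \<subseteq> fractions n"
    "\<forall>x\<in>fractions 0. \<exists>l\<in>L. x - l \<in> fractions 1"
    using ex_coefficient_ring[OF n] by blast
  interpret filtered_overring fractions to_fract d n L
  proof
    show "unital_ring_hom (to_fract :: 'k mpoly \<Rightarrow> _)" by (simp add: unital_ring_hom_def)
    show "to_fract r \<in> fractions 0" if "r \<in> mpolys_over d UNIV" for r
      using that by (intro to_fract_fractions) (simp add: power_Q_0 carrier_mpoly_ring)
  qed (use n L in auto)
  have "to_fract f \<in> fractions n"
  proof (rule mem_Mn_if_diff_ops)
    show "f \<in> mpolys_over d UNIV" using f by (simp add: carrier_mpoly_ring)
    show "to_fract (\<delta> f) \<in> fractions 1" if "\<delta> \<in> diff_ops_int (mpoly_ring d) (n - 1)" for \<delta>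
      using \<delta>[OF that] by (intro to_fract_fractions) (simp add: power_Q_Suc_0)
  qed
  then obtain s where "s \<in> carrier (mpoly_ring d) - Q" "s * f \<in> power_Q n"
    by (rule mem_power_Q_if_fraction)
  then show ?thesis
    using f by (auto simp: mem_symbolic_power_iff[OF R.domain_axioms prime_Q] power_Q_def)
qed

end

section \<open>The Zariski-Nagata theorem\<close>

theorem theorem1:
  fixes Q :: "((nat \<Rightarrow>\<^sub>0 nat) \<Rightarrow>\<^sub>0 'k::field) set" and d n :: nat
  assumes "primeideal Q (mpoly_ring d)" and "n \<ge> 1"
  shows "symbolic_power (mpoly_ring d) Q n =
    {f \<in> carrier (mpoly_ring d). \<forall>\<delta> \<in> diff_ops_int (mpoly_ring d) (n - 1). \<delta> f \<in> Q}"
proof -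
  interpret mpoly_prime Q d by (rule mpoly_prime.intro[OF assms(1)])
  show ?thesis
  proof (intro equalityI subsetI CollectI conjI ballI)
    fix f assume f: "f \<in> symbolic_power (mpoly_ring d) Q n"
    then show "f \<in> carrier (mpoly_ring d)" by (simp add: symbolic_power_def Let_def)
    fix \<delta> :: "'k mpoly \<Rightarrow> 'k mpoly"
    assume "\<delta> \<in> diff_ops_int (mpoly_ring d) (n - 1)"
    then show "\<delta> f \<in> Q"
      unfolding diff_ops_int_def
      by (rule diff_ops_symbolic_power[OF R.domain_axioms assms(1)]) (use f assms(2) in simp)
  next
    fix f
    assume "f \<in> {f \<in> carrier (mpoly_ring d). \<forall>\<delta>\<in>diff_ops_int (mpoly_ring d) (n - 1). \<delta> f \<in> Q}"
    then show "f \<in> symbolic_power (mpoly_ring d) Q n"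
      using mem_symbolic_power_if_diff_ops[OF assms(2)] by blast
  qed
qed

end
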